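(* Let $\mathcal E$ be an ES and $>$ a $\mathcal B$-compatible reduction order. For every fair and non-failing run $(\mathcal E_0,\mathcal R_0)\vdash_{\mathcal I_A}(\mathcal E_1,\mathcal R_1)\vdash_{\mathcal I_A}\cdots\vdash_{\mathcal I_A}(\mathcal E_n,\mathcal R_n)$ for $\mathcal E$, the TRS $\mathcal R_n$ is a $\mathcal B$-complete representation of $\mathcal E$: $\leftrightarrow^*_{\mathcal E\cup\mathcal B}=\leftrightarrow^*_{\mathcal R_n\cup\mathcal B}$, $\mathcal R_n$ is terminating modulo $\mathcal B$, and $\mathcal R_n$ is Church–Rosser modulo $\mathcal B$.
   Context: Terms over a signature $\mathcal F$ and variables. A rule $\ell\to r$: $\ell$ not a variable, $\mathrm{Var}(r)\subseteq\mathrm{Var}(\ell)$. For a set $\mathcal E$ of pairs of terms (equations and rules read as oriented pairs), $s\to_{\mathcal E}t$ iff $s|_p=\ell\sigma$, $t=s[r\sigma]_p$ for some $(\ell,r)\in\mathcal E$, position $p$, substitution $\sigma$; $\leftarrow$ is the inverse, $\leftrightarrow$ the symmetric closure. $\mathcal B$ is a fixed ES with $\mathrm{Var}(\ell)=\mathrm{Var}(r)$ for all $\ell\approx r\in\mathcal B$; $\sim_{\mathcal B}=\leftrightarrow^*_{\mathcal B}$, $\mathcal B^\pm=\mathcal B\cup\{t\approx s\mid s\approx t\in\mathcal B\}$; $\to_{\mathcal R/\mathcal B}=\sim_{\mathcal B}\cdot\to_{\mathcal R}\cdot\sim_{\mathcal B}$; $s\downarrow^\sim_{\mathcal R}t$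 iff $s\to^*_{\mathcal R}\cdot\sim_{\mathcal B}\cdot\leftarrow^*_{\mathcal R}t$. $\mathcal R$ is terminating modulo $\mathcal B$ if $\to_{\mathcal R/\mathcal B}$ admits no infinite sequence, Church–Rosser modulo $\mathcal B$ if $\leftrightarrow^*_{\mathcal R\cup\mathcal B}\subseteq\downarrow^\sim_{\mathcal R}$. A $\mathcal B$-compatible reduction order is a well-founded order on terms closed under contexts and substitutions with $\sim_{\mathcal B}\cdot>\cdot\sim_{\mathcal B}\subseteq>$. Inference system $\mathcal I_A$ (parameterized by $>$) on pairs $(\mathcal E,\mathcal R)$ ($\uplus$ disjoint union, $s\approx^\pm t$ means $s\approx t$ or $t\approx s$): Deduce (peak): $(\mathcal E,\mathcal R)\vdash(\mathcal E\cup\{s\approx t\},\mathcal R)$ if $s\leftarrow_{\mathcal R}\cdot\to_{\mathcal R}t$. Deduce (cliff): $(\mathcal E,\mathcal R)\vdash(\mathcal E,\mathcal R\cup\{t\to s\})$ if $s\leftarrow_{\mathcal R}\cdot\leftrightarrow_{\mathcal B}t$. Orient: $(\mathcal E\uplus\{s\approx^\pm t\},\mathcal R)\vdash(\mathcal E,\mathcal R\cup\{s\to t\})$ if $s>t$. Delete: $(\mathcal E\uplus\{s\approx t\},\mathcal R)\vdash(\mathcal E,\mathcal R)$ if $s\sim_{\mathcal B}t$. Simplify: $(\mathcal E\uplus\{s\approx^\pm t\},\mathcal R)\vdash(\mathcal E\cup\{u\approx t\},\mathcal R)$ if $s\to_{\mathcal R/\mathcal B}u$. Collapse: $(\mathcal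 E,\mathcal R\uplus\{s\to t\})\vdash(\mathcal E\cup\{u\approx t\},\mathcal R)$ if $s\to_{\mathcal R}u$. Compose: $(\mathcal E,\mathcal R\uplus\{s\to t\})\vdash(\mathcal E,\mathcal R\cup\{s\to u\})$ if $t\to_{\mathcal R/\mathcal B}u$. A run for $\mathcal E$ is a finite sequence of $\mathcal I_A$-steps from $(\mathcal E_0,\mathcal R_0)=(\mathcal E,\varnothing)$ to $(\mathcal E_n,\mathcal R_n)$; it fails if $\mathcal E_n\neq\varnothing$. It is fair if $\mathcal R_n$ is left-linear and $\mathrm{PCP}(\mathcal R_n)\subseteq\ \downarrow^\sim_{\mathcal R_n}\cup\bigcup_{i=0}^n\leftrightarrow_{\mathcal E_i\cup\mathcal R_i}$ and $\mathrm{PCP}^\pm(\mathcal R_n,\mathcal B^\pm)\subseteq\ \downarrow^\sim_{\mathcal R_n}\cup\bigcup_{i=0}^n\leftrightarrow_{\mathcal R_i}$. Critical pairs: for sets of oriented pairs $\mathcal R_1,\mathcal R_2$ (equations of $\mathcal B^\pm$ read as oriented pairs), an overlap is $\langle\ell_1\to r_1,p,\ell_2\to r_2\rangle$ with $\ell_i\to r_i$ variants of elements of $\mathcal R_i$ without common variables, $p$ a non-variable position of $\ell_2$, $\ell_1$ and $\ell_2|_p$ unifiable, and the two rules not variants if $p=\epsilon$; with an mgu $\sigma$ it yields the critical peak $\ell_2\sigma[r_1\sigma]_p\leftarrow^p\ell_2\sigma\to^\epsilon r_2\sigma$ and critical pair $\ell_2\sigma[r_1\sigma]_p\approx r_2\sigma$.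 The peak is prime if all proper subterms of $\ell_2\sigma|_p$ are normal forms w.r.t. the TRS $\mathcal R$ under consideration (also for overlaps involving $\mathcal B^\pm$). $\mathrm{PCP}(\mathcal R)$: prime critical pairs from overlaps of $\mathcal R$ with itself; $\mathrm{PCP}^\pm(\mathcal R,\mathcal B^\pm)$: prime critical pairs from overlaps between $\mathcal R$ and $\mathcal B^\pm$ in either order. *)

theory Defs
  imports Main
begin

datatype ('f, 'v) trm = Var 'v | Fun 'f "('f, 'v) trm list"

type_synonym ('f, 'v) rule = "('f, 'v) trm \<times> ('f, 'v) trm"

fun vars :: "('f, 'v) trm \<Rightarrow> 'v set" where
  "vars (Var x) = {x}"
| "vars (Fun f ts) = \<Union> (set (map vars ts))"

fun subst :: "('f, 'v) trm \<Rightarrow> ('v \<Rightarrow> ('f, 'v) trm) \<Rightarrow> ('f, 'v) trm" where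
  "subst (Var x) \<sigma> = \<sigma> x"
| "subst (Fun f ts) \<sigma> = Fun f (map (\<lambda>t. subst t \<sigma>) ts)"

function poss :: "('f, 'v) trm \<Rightarrow> nat list set" where
  "poss (Var x) = {[]}"
| "poss (Fun f ts) = insert [] (\<Union>i \<in> {..<length ts}. (Cons i) ` poss (ts ! i))"
  by pat_completeness auto
termination
  by (relation "measure size") (auto intro!: size_list_estimation' nth_mem le_imp_less_Suc)

fun subt_at :: "('f, 'v) trm \<Rightarrow> nat list \<Rightarrow> ('f, 'v) trm" where
  "subt_at t [] = t"
| "subt_at (Var x) (i # p) = Var x"
| "subt_at (Fun f ts) (i # p) = (if i < length ts then subt_at (ts ! i) p else Fun f ts)"

fun replace_at :: "('f, 'v) trm \<Rightarrow> nat list \<Rightarrow> ('f, 'v) trm \<Rightarrow> ('f, 'v) trm" where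
  "replace_at t [] s = s"
| "replace_at (Var x) (i # p) s = Var x"
| "replace_at (Fun f ts) (i # p) s =
     (if i < length ts then Fun f (ts[i := replace_at (ts ! i) p s]) else Fun f ts)"

fun linear :: "('f, 'v) trm \<Rightarrow> bool" where
  "linear (Var x) = True"
| "linear (Fun f ts) = ((\<forall>t \<in> set ts. linear t) \<and>
     (\<forall>i j. i < length ts \<longrightarrow> j < length ts \<longrightarrow> i \<noteq> j \<longrightarrow> vars (ts ! i) \<inter> vars (ts ! j) = {}))"

definition left_linear :: "('f, 'v) rule set \<Rightarrow> bool" where
  "left_linear R \<longleftrightarrow> (\<forall>(l, r) \<in> R. linear l)"

definition rstep :: "('f, 'v) rule set \<Rightarrow> ('f, 'v) trm rel" where
  "rstep R = {(s, t). \<exists>l r p \<sigma>. (l, r) \<in> R \<and> p \<in> poss s \<and> subt_at s p = subst l \<sigma>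
                  \<and> t = replace_at s p (subst r \<sigma>)}"

definition sstep :: "('f, 'v) rule set \<Rightarrow> ('f, 'v) trm rel" where
  "sstep R = rstep R \<union> (rstep R)\<inverse>"

definition conv :: "('f, 'v) rule set \<Rightarrow> ('f, 'v) trm rel" where
  "conv R = (sstep R)\<^sup>*"

definition simB :: "('f, 'v) rule set \<Rightarrow> ('f, 'v) trm rel" where
  "simB B = conv B"

definition Bpm :: "('f, 'v) rule set \<Rightarrow> ('f, 'v) rule set" where
  "Bpm B = B \<union> B\<inverse>"

definition rel_mod :: "('f, 'v) rule set \<Rightarrow> ('f, 'v) rule set \<Rightarrow> ('f, 'v) trm rel" where
  "rel_mod R B = simB B O rstep R O simB B"

definition join_mod :: "('f, 'v) rule set \<Rightarrow> ('f, 'v) rule set \<Rightarrow> ('f, 'v) trm rel" where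
  "join_mod R B = (rstep R)\<^sup>* O simB B O ((rstep R)\<inverse>)\<^sup>*"

definition SN_rel :: "'a rel \<Rightarrow> bool" where
  "SN_rel S \<longleftrightarrow> \<not> (\<exists>f. \<forall>i. (f i, f (Suc i)) \<in> S)"

definition terminating_mod :: "('f, 'v) rule set \<Rightarrow> ('f, 'v) rule set \<Rightarrow> bool" where
  "terminating_mod R B \<longleftrightarrow> SN_rel (rel_mod R B)"

definition CR_mod :: "('f, 'v) rule set \<Rightarrow> ('f, 'v) rule set \<Rightarrow> bool" where
  "CR_mod R B \<longleftrightarrow> conv (R \<union> B) \<subseteq> join_mod R B"

definition NF :: "('f, 'v) rule set \<Rightarrow> ('f, 'v) trm \<Rightarrow> bool" where
  "NF R t \<longleftrightarrow> (\<nexists>u. (t, u) \<in> rstep R)"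

definition B_compatible_reduction_order :: "('f, 'v) rule set \<Rightarrow> ('f, 'v) trm rel \<Rightarrow> bool" where
  "B_compatible_reduction_order B gt \<longleftrightarrow>
     irrefl gt \<and> trans gt \<and> SN_rel gt
   \<and> (\<forall>s t u p. (s, t) \<in> gt \<longrightarrow> p \<in> poss u \<longrightarrow> (replace_at u p s, replace_at u p t) \<in> gt)
   \<and> (\<forall>s t \<sigma>. (s, t) \<in> gt \<longrightarrow> (subst s \<sigma>, subst t \<sigma>) \<in> gt)
   \<and> simB B O gt O simB B \<subseteq> gt"

definition variant :: "('f, 'v) rule \<Rightarrow> ('f, 'v) rule \<Rightarrow> bool" where
  "variant \<rho> \<rho>' \<longleftrightarrow> (\<exists>\<pi>. bij \<pi> \<and> fst \<rho>' = subst (fst \<rho>) (Var \<circ> \<pi>) \<and> snd \<rho>' = subst (snd \<rho>) (Var \<circ> \<pi>))"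

definition is_mgu :: "('v \<Rightarrow> ('f, 'v) trm) \<Rightarrow> ('f, 'v) trm \<Rightarrow> ('f, 'v) trm \<Rightarrow> bool" where
  "is_mgu \<sigma> s t \<longleftrightarrow> subst s \<sigma> = subst t \<sigma> \<and>
     (\<forall>\<tau>. subst s \<tau> = subst t \<tau> \<longrightarrow> (\<exists>\<delta>. \<forall>x. \<tau> x = subst (\<sigma> x) \<delta>))"

definition rule_vars :: "('f, 'v) rule \<Rightarrow> 'v set" where
  "rule_vars \<rho> = vars (fst \<rho>) \<union> vars (snd \<rho>)"

definition overlap :: "('f, 'v) rule set \<Rightarrow> ('f, 'v) rule set \<Rightarrow>
    ('f, 'v) rule \<Rightarrow> nat list \<Rightarrow> ('f, 'v) rule \<Rightarrow> bool" where
  "overlap R1 R2 \<rho>1 p \<rho>2 \<longleftrightarrow>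
     (\<exists>\<rho> \<in> R1. variant \<rho> \<rho>1) \<and> (\<exists>\<rho> \<in> R2. variant \<rho> \<rho>2)
   \<and> rule_vars \<rho>1 \<inter> rule_vars \<rho>2 = {}
   \<and> p \<in> poss (fst \<rho>2) \<and> (\<nexists>x. subt_at (fst \<rho>2) p = Var x)
   \<and> (\<exists>\<tau>. subst (fst \<rho>1) \<tau> = subst (subt_at (fst \<rho>2) p) \<tau>)
   \<and> (p = [] \<longrightarrow> \<not> variant \<rho>1 \<rho>2)"

definition PCP_gen :: "('f, 'v) rule set \<Rightarrow> ('f, 'v) rule set \<Rightarrow> ('f, 'v) rule set \<Rightarrow> ('f, 'v) rule set" where
  "PCP_gen R R1 R2 = {(replace_at (subst (fst \<rho>2) \<sigma>) p (subst (snd \<rho>1) \<sigma>), subst (snd \<rho>2) \<sigma>) | \<rho>1 p \<rho>2 \<sigma>.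
      overlap R1 R2 \<rho>1 p \<rho>2 \<and> is_mgu \<sigma> (fst \<rho>1) (subt_at (fst \<rho>2) p)
    \<and> (\<forall>q \<in> poss (subt_at (subst (fst \<rho>2) \<sigma>) p). q \<noteq> [] \<longrightarrow>
          NF R (subt_at (subt_at (subst (fst \<rho>2) \<sigma>) p) q))}"

definition PCP :: "('f, 'v) rule set \<Rightarrow> ('f, 'v) rule set" where
  "PCP R = PCP_gen R R R"

definition PCP_pm :: "('f, 'v) rule set \<Rightarrow> ('f, 'v) rule set \<Rightarrow> ('f, 'v) rule set" where
  "PCP_pm R B = PCP_gen R R (Bpm B) \<union> PCP_gen R (Bpm B) R"

type_synonym ('f, 'v) state = "('f, 'v) rule set \<times> ('f, 'v) rule set"

inductive IA_step :: "('f, 'v) rule set \<Rightarrow> ('f, 'v) trm rel \<Rightarrow>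
    ('f, 'v) state \<Rightarrow> ('f, 'v) state \<Rightarrow> bool" for B gt where
  deduce_peak: "(s, t) \<in> (rstep R)\<inverse> O rstep R \<Longrightarrow>
     IA_step B gt (E, R) (E \<union> {(s, t)}, R)"
| deduce_cliff: "(s, t) \<in> (rstep R)\<inverse> O sstep B \<Longrightarrow>
     IA_step B gt (E, R) (E, R \<union> {(t, s)})"
| orient: "e \<in> E \<Longrightarrow> e = (s, t) \<or> e = (t, s) \<Longrightarrow> (s, t) \<in> gt \<Longrightarrow>
     IA_step B gt (E, R) (E - {e}, R \<union> {(s, t)})"
| delete: "(s, t) \<in> E \<Longrightarrow> (s, t) \<in> simB B \<Longrightarrow>
     IA_step B gt (E, R) (E - {(s, t)}, R)"
| simplify: "e \<in> E \<Longrightarrow> e = (s, t) \<or> e = (t, s) \<Longrightarrow> (s, u) \<in> rel_mod R B \<Longrightarrow>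
     IA_step B gt (E, R) ((E - {e}) \<union> {(u, t)}, R)"
| collapse: "(s, t) \<in> R \<Longrightarrow> (s, u) \<in> rstep (R - {(s, t)}) \<Longrightarrow>
     IA_step B gt (E, R) (E \<union> {(u, t)}, R - {(s, t)})"
| compose: "(s, t) \<in> R \<Longrightarrow> (t, u) \<in> rel_mod (R - {(s, t)}) B \<Longrightarrow>
     IA_step B gt (E, R) (E, (R - {(s, t)}) \<union> {(s, u)})"

definition is_run :: "('f, 'v) rule set \<Rightarrow> ('f, 'v) trm rel \<Rightarrow> ('f, 'v) rule set \<Rightarrow>
    (nat \<Rightarrow> ('f, 'v) state) \<Rightarrow> nat \<Rightarrow> bool" where
  "is_run B gt E run n \<longleftrightarrow> run 0 = (E, {}) \<and> (\<forall>i < n. IA_step B gt (run i) (run (Suc i)))"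

definition fails :: "(nat \<Rightarrow> ('f, 'v) state) \<Rightarrow> nat \<Rightarrow> bool" where
  "fails run n \<longleftrightarrow> fst (run n) \<noteq> {}"

definition fair :: "('f, 'v) rule set \<Rightarrow> (nat \<Rightarrow> ('f, 'v) state) \<Rightarrow> nat \<Rightarrow> bool" where
  "fair B run n \<longleftrightarrow> left_linear (snd (run n))
   \<and> PCP (snd (run n)) \<subseteq> join_mod (snd (run n)) B \<union> (\<Union>i \<le> n. sstep (fst (run i) \<union> snd (run i)))
   \<and> PCP_pm (snd (run n)) B \<subseteq> join_mod (snd (run n)) B \<union> (\<Union>i \<le> n. sstep (snd (run i)))"

end

theory Submission
  imports Defs
begin

text \<open>
  Write \<open>s \<approx>\<^sub>u t\<close> if \<open>s\<close> and \<open>t\<close> are connected by a conversion of the final system modulo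
  \<open>B\<close> all of whose terms are strictly smaller than \<open>u\<close>. Backwards along the run, every rule step
  \<open>s \<rightarrow> t\<close> of an intermediate system yields a step \<open>s \<rightarrow> s'\<close> of the final system with
  \<open>s' \<approx>\<^sub>s t\<close>, and every equation step between \<open>s\<close> and \<open>t\<close> yields \<open>s \<approx>\<^sub>w t\<close> for all \<open>w\<close> above
  both; no encompassment condition is needed on collapse because the run is finite. By fairness each
  prime critical peak \<open>s \<leftarrow> u \<rightarrow> t\<close> then satisfies \<open>s \<approx>\<^sub>u t\<close>, and each prime critical cliff
  \<open>s \<leftarrow> u \<leftrightarrow> t\<close> with a \<open>B\<close>-step on the right satisfies \<open>t \<rightarrow> s' \<approx>\<^sub>u s\<close> for some \<open>s'\<close>.
  A peak or cliff that is not prime is split at an innermost redex \<open>u \<rightarrow> v\<close> below both of its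
  positions; variable overlaps are harmless since left-hand sides are linear and \<open>B\<close> preserves
  variables. Well-founded induction on \<open>u\<close> turns these local properties into the Church-Rosser
  property modulo \<open>B\<close>.
\<close>

section \<open>Terms and positions\<close>

lemma Nil_in_poss [simp]: "[] \<in> poss t"
  by (cases t) auto

lemma Cons_in_poss_Fun [simp]: "i # p \<in> poss (Fun f ts) \<longleftrightarrow> i < length ts \<and> p \<in> poss (ts ! i)"
  by auto

lemma Cons_in_poss_Var [simp]: "i # p \<notin> poss (Var x)"
  by auto

declare poss.simps [simp del]

text \<open>Walks down a position and its term together, so that every index met is valid by
  construction and the position laws reduce to list simplification.\<close>

lemma poss_induct [consumes 1, case_names Nil Cons]:
  assumes "p \<in> poss t"
    and "\<And>t. P t []"
    and "\<And>f ts i p. i < length ts \<Longrightarrow> p \<in> poss (ts ! i) \<Longrightarrow> P (ts ! i) p \<Longrightarrow> P (Fun f ts) (i # p)"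
  shows "P t p"
  using assms(1)
proof (induction p arbitrary: t)
  case Nil
  then show ?case using assms(2) by simp
next
  case (Cons i p)
  then show ?case using assms(3) by (cases t) auto
qed

lemma poss_append: "p \<in> poss t \<Longrightarrow> p @ q \<in> poss t \<longleftrightarrow> q \<in> poss (subt_at t p)"
  by (induction rule: poss_induct) auto

lemma subt_at_append: "p \<in> poss t \<Longrightarrow> subt_at t (p @ q) = subt_at (subt_at t p) q"
  by (induction rule: poss_induct) auto

lemma replace_at_append:
  "p \<in> poss t \<Longrightarrow> replace_at t (p @ q) s = replace_at t p (replace_at (subt_at t p) q s)"
  by (induction rule: poss_induct) auto

lemma poss_replace_at [simp]: "p \<in> poss t \<Longrightarrow> p \<in> poss (replace_at t p s)"
  by (induction rule: poss_induct) auto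

lemma subt_at_replace_at [simp]: "p \<in> poss t \<Longrightarrow> subt_at (replace_at t p s) p = s"
  by (induction rule: poss_induct) auto

lemma replace_at_subt_at [simp]: "p \<in> poss t \<Longrightarrow> replace_at t p (subt_at t p) = t"
  by (induction rule: poss_induct) auto

lemma replace_at_replace_at [simp]:
  "p \<in> poss t \<Longrightarrow> replace_at (replace_at t p a) p b = replace_at t p b"
  by (induction rule: poss_induct) auto

section \<open>Relative location of two positions\<close>

definition parallel_pos :: "nat list \<Rightarrow> nat list \<Rightarrow> bool" where
  "parallel_pos p q \<longleftrightarrow> (\<exists>c i j p' q'. i \<noteq> j \<and> p = c @ i # p' \<and> q = c @ j # q')"

lemma parallel_pos_sym: "parallel_pos p q \<Longrightarrow> parallel_pos q p"
  unfolding parallel_pos_def by metis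

lemma position_cases:
  obtains (below) r where "q = p @ r" | (above) r where "p = q @ r" | (parallel) "parallel_pos p q"
proof -
  have "(\<exists>r. q = p @ r) \<or> (\<exists>r. p = q @ r) \<or> parallel_pos p q"
  proof (induction p arbitrary: q)
    case (Cons i p)
    show ?case
    proof (cases q)
      case (Cons j q')
      show ?thesis
      proof (cases "i = j")
        case True
        from Cons.IH[of q'] show ?thesis
          unfolding Cons True parallel_pos_def by (metis append_Cons)
      next
        case False
        then have "parallel_pos (i # p) q"
          unfolding Cons parallel_pos_def by (metis append_Nil)
        then show ?thesis by simp
      qed
    qed simp
  qed simp
  then show thesis using that by blast
qed

lemma parallel_replace_at:
  assumes "parallel_pos p q" "p \<in> poss t" "q \<in> poss t"
  shows "q \<in> poss (replace_at t p a)"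
    and "subt_at (replace_at t p a) q = subt_at t q"
    and "replace_at (replace_at t p a) q b = replace_at (replace_at t q b) p a"
proof -
  obtain c i j p' q' where ij: "i \<noteq> j" and pq: "p = c @ i # p'" "q = c @ j # q'"
    using assms(1) unfolding parallel_pos_def by blast
  have "q \<in> poss (replace_at t p a) \<and> subt_at (replace_at t p a) q = subt_at t q \<and>
    replace_at (replace_at t p a) q b = replace_at (replace_at t q b) p a"
    using assms(2,3) unfolding pq
  proof (induction c arbitrary: t)
    case Nil
    then show ?case using ij by (cases t) (auto simp: list_update_swap)
  next
    case (Cons k c)
    then show ?case by (cases t) auto
  qed
  then show "q \<in> poss (replace_at t p a)"
    and "subt_at (replace_at t p a) q = subt_at t q"
    and "replace_at (replace_at t p a) q b = replace_at (replace_at t q b) p a"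
    by auto
qed

lemma size_subt_at: "q \<in> poss t \<Longrightarrow> q \<noteq> [] \<Longrightarrow> size (subt_at t q) < size t"
proof (induction rule: poss_induct)
  case (Cons f ts i p)
  have "size (ts ! i) < size (Fun f ts)"
    using Cons.hyps by (auto intro!: size_list_estimation' nth_mem le_imp_less_Suc)
  then show ?case using Cons by (cases "p = []") auto
qed simp

lemma subst_cong: "(\<And>x. x \<in> vars t \<Longrightarrow> \<sigma> x = \<tau> x) \<Longrightarrow> subst t \<sigma> = subst t \<tau>"
  by (induction t) auto

lemma subst_eqD: "subst t \<sigma> = subst t \<tau> \<Longrightarrow> x \<in> vars t \<Longrightarrow> \<sigma> x = \<tau> x"
  by (induction t) auto

lemma subst_subst: "subst (subst t \<sigma>) \<tau> = subst t (\<lambda>x. subst (\<sigma> x) \<tau>)"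
  by (induction t) auto

lemma subst_Var [simp]: "subst t Var = t"
  by (induction t) (auto simp: map_idI)

lemma finite_vars [simp]: "finite (vars t)"
  by (induction t) auto

lemma vars_subst: "vars (subst t \<sigma>) = (\<Union>x \<in> vars t. vars (\<sigma> x))"
  by (induction t) auto

lemma poss_subst: "p \<in> poss t \<Longrightarrow> p \<in> poss (subst t \<sigma>)"
  by (induction rule: poss_induct) auto

lemma subt_at_subst: "p \<in> poss t \<Longrightarrow> subt_at (subst t \<sigma>) p = subst (subt_at t p) \<sigma>"
  by (induction rule: poss_induct) auto

lemma subst_replace_at:
  "p \<in> poss t \<Longrightarrow> subst (replace_at t p s) \<sigma> = replace_at (subst t \<sigma>) p (subst s \<sigma>)"
  by (induction rule: poss_induct) (auto simp: map_update)

text \<open>Separates the two kinds of nested redexes: a function position of \<open>t\<close> leads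
  to an overlap, whereas every other position lies in the substitution part, at or under a variable
  of \<open>t\<close>.\<close>

lemma poss_subst_cases:
  assumes "p \<in> poss (subst t \<sigma>)"
  obtains (inside) "p \<in> poss t" "\<nexists>x. subt_at t p = Var x"
  | (var) q r x where "p = q @ r" "q \<in> poss t" "subt_at t q = Var x" "r \<in> poss (\<sigma> x)"
proof -
  have "(p \<in> poss t \<and> (\<nexists>x. subt_at t p = Var x)) \<or>
    (\<exists>q r x. p = q @ r \<and> q \<in> poss t \<and> subt_at t q = Var x \<and> r \<in> poss (\<sigma> x))"
    using assms
  proof (induction p arbitrary: t)
    case Nil
    then show ?case by (cases t) auto
  next
    case (Cons i p)
    show ?case
    proof (cases t)
      case (Var x)
      then have "i # p = [] @ (i # p) \<and> [] \<in> poss t \<and> subt_at t [] = Var x \<and> i # p \<in> poss (\<sigma> x)"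
        using Cons.prems by simp
      then show ?thesis by blast
    next
      case (Fun f ts)
      have i: "i < length ts" "p \<in> poss (subst (ts ! i) \<sigma>)"
        using Cons.prems Fun by auto
      from Cons.IH[OF i(2)] show ?thesis
      proof
        assume "p \<in> poss (ts ! i) \<and> (\<nexists>x. subt_at (ts ! i) p = Var x)"
        then show ?thesis using Fun i by simp
      next
        assume "\<exists>q r x. p = q @ r \<and> q \<in> poss (ts ! i) \<and> subt_at (ts ! i) q = Var x \<and> r \<in> poss (\<sigma> x)"
        then obtain q r x where "p = q @ r" "q \<in> poss (ts ! i)" "subt_at (ts ! i) q = Var x" "r \<in> poss (\<sigma> x)"
          by blast
        then have "i # p = (i # q) @ r \<and> i # q \<in> poss t \<and> subt_at t (i # q) = Var x \<and> r \<in> poss (\<sigma> x)"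
          using Fun i by simp
        then show ?thesis by blast
      qed
    qed
  qed
  then show thesis using that by blast
qed

lemma vars_obtain_pos:
  assumes "x \<in> vars t"
  obtains p where "p \<in> poss t" "subt_at t p = Var x"
proof -
  have "\<exists>p. p \<in> poss t \<and> subt_at t p = Var x"
    using assms
  proof (induction t)
    case (Var y)
    then show ?case by (auto intro!: exI[of _ "[]"])
  next
    case (Fun f ts)
    then obtain i where i: "i < length ts" "x \<in> vars (ts ! i)"
      by (auto simp: in_set_conv_nth)
    then obtain p where "p \<in> poss (ts ! i)" "subt_at (ts ! i) p = Var x"
      using Fun.IH[of "ts ! i"] by auto
    then show ?case using i by (intro exI[of _ "i # p"]) simp
  qed
  then show thesis using that by blast
qed

lemma vars_subt_at: "p \<in> poss t \<Longrightarrow> vars (subt_at t p) \<subseteq> vars t"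
  by (induction rule: poss_induct) (auto, metis nth_mem subsetD)

text \<open>By linearity \<open>p\<close> is the only occurrence of \<open>x\<close>, so one
  replacement there already accounts for the whole change from \<open>\<sigma>\<close> to
  \<open>\<sigma>'\<close>.\<close>

lemma linear_replace_var:
  assumes "p \<in> poss t" "linear t" "subt_at t p = Var x" "\<And>y. y \<noteq> x \<Longrightarrow> \<sigma>' y = \<sigma> y"
  shows "replace_at (subst t \<sigma>) p (\<sigma>' x) = subst t \<sigma>'"
  using assms(1-3)
proof (induction rule: poss_induct)
  case (Nil t)
  then show ?case by simp
next
  case (Cons f ts i p)
  have x: "x \<in> vars (ts ! i)"
    using vars_subt_at[OF Cons.hyps(2)] Cons.prems Cons.hyps by auto
  \<comment> \<open>\<open>x\<close> occurs in argument \<open>i\<close>, hence linearity keeps it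
    out of all other arguments.\<close>
  have other: "subst (ts ! j) \<sigma> = subst (ts ! j) \<sigma>'" if "j < length ts" "j \<noteq> i" for j
  proof (rule subst_cong)
    fix y
    assume "y \<in> vars (ts ! j)"
    then have "y \<noteq> x" using x Cons.prems(1) Cons.hyps(1) that by auto
    then show "\<sigma> y = \<sigma>' y" using assms(4) by simp
  qed
  have "(map (\<lambda>t. subst t \<sigma>) ts)[i := subst (ts ! i) \<sigma>'] = map (\<lambda>t. subst t \<sigma>') ts"
    using Cons.hyps other by (auto intro!: nth_equalityI simp: nth_list_update)
  then show ?case using Cons by simp
qed

section \<open>Unification\<close>

definition unifies :: "('v \<Rightarrow> ('f, 'v) trm) \<Rightarrow> (('f, 'v) trm \<times> ('f, 'v) trm) list \<Rightarrow> bool" where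
  "unifies \<sigma> E \<longleftrightarrow> (\<forall>(s, t) \<in> set E. subst s \<sigma> = subst t \<sigma>)"

definition mgu_list :: "('v \<Rightarrow> ('f, 'v) trm) \<Rightarrow> (('f, 'v) trm \<times> ('f, 'v) trm) list \<Rightarrow> bool" where
  "mgu_list \<sigma> E \<longleftrightarrow> unifies \<sigma> E \<and> (\<forall>\<tau>. unifies \<tau> E \<longrightarrow> (\<exists>\<delta>. \<forall>x. \<tau> x = subst (\<sigma> x) \<delta>))"

definition vars_eqs :: "(('f, 'v) trm \<times> ('f, 'v) trm) list \<Rightarrow> 'v set" where
  "vars_eqs E = (\<Union>(s, t) \<in> set E. vars s \<union> vars t)"

definition subst_eqs :: "'v \<Rightarrow> ('f, 'v) trm \<Rightarrow> (('f, 'v) trm \<times> ('f, 'v) trm) list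
    \<Rightarrow> (('f, 'v) trm \<times> ('f, 'v) trm) list" where
  "subst_eqs x t E = map (\<lambda>(a, b). (subst a (Var(x := t)), subst b (Var(x := t)))) E"

lemma finite_vars_eqs [simp]: "finite (vars_eqs E)"
  by (auto simp: vars_eqs_def)

lemma mgu_list_equiv: "(\<And>\<tau>. unifies \<tau> E \<longleftrightarrow> unifies \<tau> E') \<Longrightarrow> mgu_list \<sigma> E \<Longrightarrow> mgu_list \<sigma> E'"
  by (simp add: mgu_list_def)

lemma occurs_size: "x \<in> vars t \<Longrightarrow> size (\<sigma> x) \<le> size (subst t \<sigma>)"
proof (induction t)
  case (Fun f ts)
  then obtain t where t: "t \<in> set ts" "x \<in> vars t" by auto
  have "size (subst t \<sigma>) \<le> size (subst (Fun f ts) \<sigma>)"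
    using t(1) by (auto intro!: size_list_estimation' le_SucI)
  then show ?case using Fun.IH[OF t] by simp
qed simp

text \<open>An occurrence of \<open>x\<close> in \<open>t\<close> would force \<open>t\<close> to be
  compound and \<open>\<sigma> x\<close> to be a proper subterm of the instance of \<open>t\<close>,
  that is, of itself; sizes exclude this.\<close>

lemma occurs_check:
  assumes "\<sigma> x = subst t \<sigma>" "t \<noteq> Var x"
  shows "x \<notin> vars t"
proof
  assume x: "x \<in> vars t"
  show False
  proof (cases t)
    case (Var y)
    then show ?thesis using x assms(2) by simp
  next
    case (Fun f ts)
    then obtain s where s: "s \<in> set ts" "x \<in> vars s" using x by auto
    have "size (subst s \<sigma>) < size (subst t \<sigma>)"
      using s(1) Fun by (auto intro!: size_list_estimation' le_imp_less_Suc)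
    then show ?thesis using occurs_size[OF s(2), of \<sigma>] assms(1) by simp
  qed
qed

text \<open>A unifier of \<open>x\<close> and \<open>t\<close> absorbs the binding
  \<open>x := t\<close>, so eliminating \<open>x\<close> loses no unifier.\<close>

lemma subst_elim: "\<tau> x = subst t \<tau> \<Longrightarrow> subst (subst a (Var(x := t))) \<tau> = subst a \<tau>"
  by (auto simp: subst_subst intro!: subst_cong)

lemma mgu_list_elim:
  assumes x: "x \<notin> vars t" and \<sigma>: "mgu_list \<sigma> (subst_eqs x t E)"
  shows "mgu_list (\<lambda>y. subst ((Var(x := t)) y) \<sigma>) ((Var x, t) # E)"
proof -
  let ?\<rho> = "\<lambda>y. subst ((Var(x := t)) y) \<sigma>"
  have t: "subst t ?\<rho> = subst t \<sigma>"
    by (rule subst_cong) (use x in auto)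
  have "unifies ?\<rho> E"
    using \<sigma> by (auto simp: mgu_list_def unifies_def subst_eqs_def subst_subst)
  then have u: "unifies ?\<rho> ((Var x, t) # E)"
    using t by (simp add: unifies_def)
  have "\<exists>\<delta>. \<forall>y. \<tau> y = subst (?\<rho> y) \<delta>" if \<tau>: "unifies \<tau> ((Var x, t) # E)" for \<tau>
  proof -
    have e: "\<tau> x = subst t \<tau>" using \<tau> by (simp add: unifies_def)
    have "unifies \<tau> (subst_eqs x t E)"
      using \<tau> by (auto simp: unifies_def subst_eqs_def subst_elim[OF e])
    then obtain \<delta> where \<delta>: "\<And>y. \<tau> y = subst (\<sigma> y) \<delta>"
      using \<sigma> by (auto simp: mgu_list_def)
    have "\<tau> y = subst (?\<rho> y) \<delta>" for y
      using e by (auto simp: subst_subst \<delta>[symmetric])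
    then show ?thesis by blast
  qed
  then show ?thesis using u by (simp add: mgu_list_def)
qed

text \<open>Elimination removes \<open>x\<close> for good; this makes the first component of the
  termination measure of unification drop.\<close>

lemma vars_subst_eqs: "x \<notin> vars t \<Longrightarrow> vars_eqs (subst_eqs x t E) \<subseteq> vars_eqs ((Var x, t) # E) - {x}"
  by (fastforce simp: vars_eqs_def subst_eqs_def vars_subst split: if_splits)

text \<open>Rule-based unification, ordered lexicographically by the number of variables and the
  total size. The given unifier excludes clashes and failing occurs checks, so each case only has to
  simplify the first equation.\<close>

lemma mgu_list_exists:
  fixes E :: "(('f, 'v) trm \<times> ('f, 'v) trm) list"
  shows "unifies \<tau> E \<Longrightarrow> \<exists>\<sigma>. mgu_list \<sigma> E"
proof (induction "(card (vars_eqs E), sum_list (map (\<lambda>(s, t). size s + size t) E))"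
    arbitrary: E \<tau> rule: wf_induct_rule[OF wf_lex_prod[OF wf_less_than wf_less_than]])
  case (1 E)
  define m where "m = (\<lambda>E :: (('f, 'v) trm \<times> ('f, 'v) trm) list. sum_list (map (\<lambda>(s, t). size s + size t) E))"
  have IH: "\<exists>\<sigma>. mgu_list \<sigma> E'"
    if "unifies \<tau>' E'" "card (vars_eqs E') < card (vars_eqs E) \<or> card (vars_eqs E') \<le> card (vars_eqs E) \<and> m E' < m E"
    for E' \<tau>'
    using 1(1)[OF _ that(1)] that(2) unfolding m_def by (auto simp: le_less)
  have elim: "\<exists>\<sigma>. mgu_list \<sigma> ((Var x, t) # E')"
    if E': "vars_eqs ((Var x, t) # E') = vars_eqs E" and u: "unifies \<tau> ((Var x, t) # E')" and t: "t \<noteq> Var x"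
    for x t E'
  proof -
    have e: "\<tau> x = subst t \<tau>" using u by (simp add: unifies_def)
    have x: "x \<notin> vars t" by (rule occurs_check[OF e t])
    have "unifies \<tau> (subst_eqs x t E')"
      using u by (auto simp: unifies_def subst_eqs_def subst_elim[OF e])
    moreover have "card (vars_eqs (subst_eqs x t E')) < card (vars_eqs E)"
    proof (rule psubset_card_mono)
      have "x \<in> vars_eqs E" unfolding E'[symmetric] by (simp add: vars_eqs_def)
      then show "vars_eqs (subst_eqs x t E') \<subset> vars_eqs E"
        using vars_subst_eqs[OF x, of E'] E' by auto
    qed simp
    ultimately obtain \<sigma> where "mgu_list \<sigma> (subst_eqs x t E')" using IH by blast
    then show ?thesis using mgu_list_elim[OF x] by blast
  qed
  show ?case
  proof (cases E)
    case Nil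
    then have "mgu_list Var E" by (simp add: mgu_list_def unifies_def) metis
    then show ?thesis by blast
  next
    case (Cons e E')
    obtain s t where e: "e = (s, t)" by (cases e)
    note E = Cons[unfolded e]
    have u: "subst s \<tau> = subst t \<tau>" "unifies \<tau> E'" using 1(2) E by (auto simp: unifies_def)
    show ?thesis
    proof (cases s)
      case s: (Var x)
      show ?thesis
      proof (cases "t = Var x")
        case True
        \<comment> \<open>Dropping a trivial equation may keep all variables, but it lowers the
          total size.\<close>
        have "card (vars_eqs E') \<le> card (vars_eqs E)"
          by (rule card_mono) (auto simp: E vars_eqs_def)
        moreover have "m E' < m E" by (simp add: m_def E s True)
        ultimately obtain \<sigma> where "mgu_list \<sigma> E'" using IH u(2) by blast
        then have "mgu_list \<sigma> E" by (rule mgu_list_equiv[rotated]) (simp add: E s True unifies_def)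
        then show ?thesis by blast
      next
        case False
        then show ?thesis using elim[of x t E'] 1(2) E s by simp
      qed
    next
      case s: (Fun f ss)
      show ?thesis
      proof (cases t)
        case t: (Var x)
        \<comment> \<open>Swapping the sides brings the variable to the left, where elimination
          applies.\<close>
        have "unifies \<tau> ((Var x, s) # E')" using u t by (simp add: unifies_def)
        moreover have "vars_eqs ((Var x, s) # E') = vars_eqs E" using E t by (auto simp: vars_eqs_def)
        ultimately obtain \<sigma> where "mgu_list \<sigma> ((Var x, s) # E')" using elim[of x s E'] s by auto
        then have "mgu_list \<sigma> E"
          by (rule mgu_list_equiv[rotated]) (auto simp: E t unifies_def)
        then show ?thesis by blast
      next
        case t: (Fun g ts)
        \<comment> \<open>The common instance under \<open>\<tau>\<close> forces equal root symbols
          and arities, so the equation decomposes into equations between arguments.\<close>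
        have fg: "f = g" and len: "length ss = length ts"
          using u(1) s t by (auto dest: map_eq_imp_length_eq)
        let ?E = "zip ss ts @ E'"
        have eq: "unifies \<rho> ?E \<longleftrightarrow> unifies \<rho> E" for \<rho>
          using len fg by (auto simp: E s t unifies_def list_eq_iff_nth_eq set_zip)
        have "vars_eqs ?E \<subseteq> vars_eqs E"
          by (auto simp: E s t vars_eqs_def dest: set_zip_leftD set_zip_rightD)
        then have "card (vars_eqs ?E) \<le> card (vars_eqs E)" by (intro card_mono) simp_all
        moreover have "sum_list (map (\<lambda>(s, t). size s + size t) (zip ss ts)) \<le> size_list size ss + size_list size ts"
          using len by (induction ss ts rule: list_induct2) auto
        then have "m ?E < m E" by (simp add: m_def E s t)
        ultimately obtain \<sigma> where "mgu_list \<sigma> ?E" using IH 1(2) eq by blast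
        then show ?thesis using mgu_list_equiv[OF eq] by blast
      qed
    qed
  qed
qed

lemma is_mgu_exists:
  assumes "subst s \<tau> = subst t \<tau>"
  shows "\<exists>\<sigma>. is_mgu \<sigma> s t"
  using mgu_list_exists[of \<tau> "[(s, t)]"] assms
  by (auto simp: mgu_list_def is_mgu_def unifies_def)

section \<open>Rewrite relations\<close>

text \<open>Closure under contexts and under substitutions in a single condition;
  \<open>rstep R\<close> is the least such relation that contains \<open>R\<close>.\<close>

definition rewrite_closed :: "('f, 'v) trm rel \<Rightarrow> bool" where
  "rewrite_closed S \<longleftrightarrow> (\<forall>s t u p \<sigma>. (s, t) \<in> S \<longrightarrow> p \<in> poss u \<longrightarrow>
     (replace_at u p (subst s \<sigma>), replace_at u p (subst t \<sigma>)) \<in> S)"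

lemma rewrite_closedD:
  "rewrite_closed S \<Longrightarrow> (s, t) \<in> S \<Longrightarrow> p \<in> poss u \<Longrightarrow>
    (replace_at u p (subst s \<sigma>), replace_at u p (subst t \<sigma>)) \<in> S"
  by (simp add: rewrite_closed_def)

lemma rewrite_closed_ctxt:
  "rewrite_closed S \<Longrightarrow> (s, t) \<in> S \<Longrightarrow> p \<in> poss u \<Longrightarrow> (replace_at u p s, replace_at u p t) \<in> S"
  using rewrite_closedD[of S s t p u Var] by simp

lemma rewrite_closed_subst: "rewrite_closed S \<Longrightarrow> (s, t) \<in> S \<Longrightarrow> (subst s \<sigma>, subst t \<sigma>) \<in> S"
  using rewrite_closedD[of S s t "[]" s \<sigma>] by simp

lemma rewrite_closedI:
  "(\<And>s t u p \<sigma>. (s, t) \<in> S \<Longrightarrow> p \<in> poss u \<Longrightarrow>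
     (replace_at u p (subst s \<sigma>), replace_at u p (subst t \<sigma>)) \<in> S) \<Longrightarrow> rewrite_closed S"
  by (simp add: rewrite_closed_def)

lemma rewrite_closed_Un: "rewrite_closed S \<Longrightarrow> rewrite_closed T \<Longrightarrow> rewrite_closed (S \<union> T)"
  by (rule rewrite_closedI) (metis Un_iff rewrite_closedD)

lemma rewrite_closed_UN: "(\<And>i. i \<in> I \<Longrightarrow> rewrite_closed (S i)) \<Longrightarrow> rewrite_closed (\<Union>i \<in> I. S i)"
  by (rule rewrite_closedI) (metis UN_iff rewrite_closedD)

lemma rewrite_closed_converse: "rewrite_closed S \<Longrightarrow> rewrite_closed (S\<inverse>)"
  by (rule rewrite_closedI) (metis converse_iff rewrite_closedD)

lemma rewrite_closed_relcomp:
  assumes "rewrite_closed S" "rewrite_closed T"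
  shows "rewrite_closed (S O T)"
proof (rule rewrite_closedI)
  fix s t u :: "('a, 'b) trm" and p \<sigma>
  assume "(s, t) \<in> S O T" and p: "p \<in> poss u"
  then obtain v where "(s, v) \<in> S" "(v, t) \<in> T" by blast
  then show "(replace_at u p (subst s \<sigma>), replace_at u p (subst t \<sigma>)) \<in> S O T"
    using rewrite_closedD[OF assms(1) _ p] rewrite_closedD[OF assms(2) _ p] by (metis relcompI)
qed

lemma rewrite_closed_rtrancl:
  assumes "rewrite_closed S"
  shows "rewrite_closed (S\<^sup>*)"
proof (rule rewrite_closedI)
  fix s t u :: "('a, 'b) trm" and p \<sigma>
  assume "(s, t) \<in> S\<^sup>*" and p: "p \<in> poss u"
  then show "(replace_at u p (subst s \<sigma>), replace_at u p (subst t \<sigma>)) \<in> S\<^sup>*"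
  proof (induction rule: rtrancl_induct)
    case (step y z)
    then show ?case using rewrite_closedD[OF assms step(2) p, of \<sigma>] by (simp add: rtrancl_into_rtrancl)
  qed simp
qed

lemma rstepI:
  "(l, r) \<in> R \<Longrightarrow> p \<in> poss u \<Longrightarrow> (replace_at u p (subst l \<sigma>), replace_at u p (subst r \<sigma>)) \<in> rstep R"
  unfolding rstep_def by (rule CollectI, rule case_prodI, rule exI[of _ l], rule exI[of _ r],
      rule exI[of _ p], rule exI[of _ \<sigma>]) simp

lemma rstepE:
  assumes "(s, t) \<in> rstep R"
  obtains l r p u \<sigma> where "(l, r) \<in> R" "p \<in> poss u"
    "s = replace_at u p (subst l \<sigma>)" "t = replace_at u p (subst r \<sigma>)"
proof -
  obtain l r p \<sigma> where "(l, r) \<in> R" "p \<in> poss s" "subt_at s p = subst l \<sigma>" "t = replace_at s p (subst r \<sigma>)"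
    using assms unfolding rstep_def by blast
  then show thesis using that[of l r p s \<sigma>] replace_at_subt_at[of p s] by simp
qed

lemma rewrite_closed_rstep: "rewrite_closed (rstep R)"
proof (rule rewrite_closedI)
  fix s t v :: "('a, 'b) trm" and q \<tau>
  assume "(s, t) \<in> rstep R" and q: "q \<in> poss v"
  then obtain l r p u \<sigma> where 1: "(l, r) \<in> R" "p \<in> poss u"
    "s = replace_at u p (subst l \<sigma>)" "t = replace_at u p (subst r \<sigma>)"
    by (blast elim: rstepE)
  let ?v = "replace_at v q (subst u \<tau>)"
  have qp: "q @ p \<in> poss ?v" using q 1(2) by (simp add: poss_append poss_subst)
  have eq: "replace_at ?v (q @ p) (subst a (\<lambda>x. subst (\<sigma> x) \<tau>)) =
    replace_at v q (subst (replace_at u p (subst a \<sigma>)) \<tau>)" for a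
    using q 1(2) by (simp add: replace_at_append subst_replace_at subst_subst)
  show "(replace_at v q (subst s \<tau>), replace_at v q (subst t \<tau>)) \<in> rstep R"
    using rstepI[OF 1(1) qp, of "\<lambda>x. subst (\<sigma> x) \<tau>"] unfolding eq 1(3,4) .
qed

lemma rstep_root: "(l, r) \<in> R \<Longrightarrow> (subst l \<sigma>, subst r \<sigma>) \<in> rstep R"
  using rstepI[of l r R "[]" l \<sigma>] by simp

lemma rstep_rule: "R \<subseteq> rstep R"
  using rstep_root[of _ _ R Var] by auto

text \<open>Minimality of the rewrite relation: to include all steps in a closed relation it
  suffices to check the rules. It is applied to the order, to conversions and to the right-hand
  sides of fairness.\<close>

lemma rstep_least: "rewrite_closed S \<Longrightarrow> R \<subseteq> S \<Longrightarrow> rstep R \<subseteq> S"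
proof (rule subrelI, erule rstepE)
  fix s t l r p u \<sigma>
  assume S: "rewrite_closed S" "R \<subseteq> S" and p: "p \<in> poss u" and lr: "(l, r) \<in> R"
    and st: "s = replace_at u p (subst l \<sigma>)" "t = replace_at u p (subst r \<sigma>)"
  then show "(s, t) \<in> S" using rewrite_closedD[OF S(1) _ p, of l r \<sigma>] by auto
qed

lemma rstep_mono: "R \<subseteq> S \<Longrightarrow> rstep R \<subseteq> rstep S"
  unfolding rstep_def by blast

lemma rstep_Un: "rstep (R \<union> S) = rstep R \<union> rstep S"
  unfolding rstep_def by blast

lemma rstep_converse: "rstep (R\<inverse>) = (rstep R)\<inverse>"
proof -
  have sub: "rstep (S\<inverse>) \<subseteq> (rstep S)\<inverse>" for S :: "('a, 'b) rule set"
    using rstep_rule[of S] by (intro rstep_least rewrite_closed_converse rewrite_closed_rstep) auto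
  show ?thesis using sub[of R] sub[of "R\<inverse>"] by auto
qed

lemma rstep_Bpm: "rstep (Bpm B) = sstep B"
  by (simp add: Bpm_def sstep_def rstep_Un rstep_converse)

lemma sstep_Un: "sstep (R \<union> S) = sstep R \<union> sstep S"
  by (auto simp: sstep_def rstep_Un)

lemma sym_sstep: "sym (sstep R)"
  by (auto simp: sstep_def sym_def)

lemma sym_simB: "sym (simB B)"
  by (simp add: simB_def conv_def sym_rtrancl sym_sstep)

lemma simB_sym: "(s, t) \<in> simB B \<Longrightarrow> (t, s) \<in> simB B"
  using sym_simB by (auto dest: symD)

lemma simB_refl [simp]: "(s, s) \<in> simB B"
  by (simp add: simB_def conv_def)

lemma sstep_simB: "(s, t) \<in> sstep B \<Longrightarrow> (s, t) \<in> simB B"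
  by (auto simp: simB_def conv_def)

lemma rewrite_closed_sstep: "rewrite_closed (sstep R)"
  by (simp add: sstep_def rewrite_closed_Un rewrite_closed_converse rewrite_closed_rstep)

lemma rewrite_closed_conv: "rewrite_closed (conv R)"
  by (simp add: conv_def rewrite_closed_rtrancl rewrite_closed_sstep)

lemma rewrite_closed_simB: "rewrite_closed (simB B)"
  by (simp add: simB_def rewrite_closed_conv)

lemma rewrite_closed_rel_mod: "rewrite_closed (rel_mod R B)"
  by (simp add: rel_mod_def rewrite_closed_relcomp rewrite_closed_simB rewrite_closed_rstep)

lemma rewrite_closed_join_mod: "rewrite_closed (join_mod R B)"
  by (simp add: join_mod_def rewrite_closed_relcomp rewrite_closed_simB rewrite_closed_rstep
      rewrite_closed_rtrancl rewrite_closed_converse)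

lemma sym_conv: "sym (conv R)"
  by (simp add: conv_def sym_rtrancl sym_sstep)

lemma conv_least: "R \<subseteq> conv S \<Longrightarrow> conv R \<subseteq> conv S"
proof -
  assume "R \<subseteq> conv S"
  then have "rstep R \<subseteq> conv S" by (rule rstep_least[OF rewrite_closed_conv])
  then have "sstep R \<subseteq> conv S"
    using sym_conv[of S] by (auto simp: sstep_def dest: symD)
  then show ?thesis unfolding conv_def by (simp add: rtrancl_subset_rtrancl)
qed

lemma NF_subst: "NF R (subst t \<sigma>) \<Longrightarrow> NF R t"
  using rewrite_closed_subst[OF rewrite_closed_rstep] unfolding NF_def by blast

section \<open>Rewriting the substitution part of a term\<close>

lemma rsteps_arg:
  assumes "(ts ! i, s) \<in> (rstep R)\<^sup>*" "i < length ts"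
  shows "(Fun f ts, Fun f (ts[i := s])) \<in> (rstep R)\<^sup>*"
  using rewrite_closed_ctxt[OF rewrite_closed_rtrancl[OF rewrite_closed_rstep] assms(1), of "[i]" "Fun f ts"] assms(2)
  by simp

lemma rsteps_args:
  assumes "length ts = length ss" "\<And>i. i < length ts \<Longrightarrow> (ts ! i, ss ! i) \<in> (rstep R)\<^sup>*"
  shows "(Fun f ts, Fun f ss) \<in> (rstep R)\<^sup>*"
proof -
  \<comment> \<open>Arguments are rewritten from left to right; the intermediate term has its first
    \<open>k\<close> arguments done.\<close>
  have "k \<le> length ts \<Longrightarrow> (Fun f ts, Fun f (take k ss @ drop k ts)) \<in> (rstep R)\<^sup>*" for k
  proof (induction k)
    case (Suc k)
    let ?ts = "take k ss @ drop k ts"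
    have "?ts ! k = ts ! k" using Suc.prems assms(1) by (simp add: nth_append)
    then have "(Fun f ?ts, Fun f (?ts[k := ss ! k])) \<in> (rstep R)\<^sup>*"
      using Suc.prems assms by (intro rsteps_arg) simp_all
    moreover have "?ts[k := ss ! k] = take (Suc k) ss @ drop (Suc k) ts"
      using Suc.prems assms(1)
      by (intro nth_equalityI) (auto simp: nth_append nth_list_update less_Suc_eq min_def)
    ultimately show ?case using Suc by simp
  qed simp
  from this[of "length ts"] show ?thesis using assms(1) by simp
qed

lemma subst_rsteps:
  "(\<And>x. (\<sigma> x, \<sigma>' x) \<in> (rstep R)\<^sup>*) \<Longrightarrow> (subst t \<sigma>, subst t \<sigma>') \<in> (rstep R)\<^sup>*"
  by (induction t) (auto intro!: rsteps_args)

text \<open>Once one occurrence of \<open>x\<close> is replaced, the remaining occurrences catch up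
  by further steps; this covers terms in which \<open>x\<close> is repeated.\<close>

lemma replace_var_rsteps:
  assumes "p \<in> poss t" "subt_at t p = Var x" "\<And>y. (\<sigma> y, \<sigma>' y) \<in> (rstep R)\<^sup>*"
  shows "(replace_at (subst t \<sigma>) p (\<sigma>' x), subst t \<sigma>') \<in> (rstep R)\<^sup>*"
  using assms(1,2)
proof (induction rule: poss_induct)
  case (Cons f ts i p)
  then show ?case
    by (auto intro!: rsteps_args simp: nth_list_update subst_rsteps[OF assms(3)])
qed simp

lemma update_rsteps:
  assumes "(\<sigma> x, \<sigma>' x) \<in> rstep S" "\<And>y. y \<noteq> x \<Longrightarrow> \<sigma>' y = \<sigma> y"
  shows "(\<sigma> y, \<sigma>' y) \<in> (rstep S)\<^sup>*"
  using assms by (cases "y = x") auto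

section \<open>Critical peaks\<close>

definition rstep_at :: "('f, 'v) rule set \<Rightarrow> nat list \<Rightarrow> ('f, 'v) trm rel" where
  "rstep_at R p = {(s, t). \<exists>l r \<sigma>. (l, r) \<in> R \<and> p \<in> poss s \<and> subt_at s p = subst l \<sigma>
                  \<and> t = replace_at s p (subst r \<sigma>)}"

lemma rstep_iff_rstep_at: "(s, t) \<in> rstep R \<longleftrightarrow> (\<exists>p. (s, t) \<in> rstep_at R p)"
  unfolding rstep_def rstep_at_def by blast

lemma rstep_atE:
  assumes "(s, t) \<in> rstep_at R p"
  obtains l r \<sigma> where "(l, r) \<in> R" "p \<in> poss s" "subt_at s p = subst l \<sigma>" "t = replace_at s p (subst r \<sigma>)"
  using assms unfolding rstep_at_def by blast

lemma parallel_rstep_at: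
  assumes "(u, s) \<in> rstep_at R1 p" "(u, t) \<in> rstep_at R2 q" "parallel_pos p q"
  obtains w where "(s, w) \<in> rstep R2" "(t, w) \<in> rstep R1"
proof -
  obtain l1 r1 \<sigma>1 where 1: "(l1, r1) \<in> R1" "p \<in> poss u" "subt_at u p = subst l1 \<sigma>1"
    "s = replace_at u p (subst r1 \<sigma>1)" using assms(1) by (rule rstep_atE)
  obtain l2 r2 \<sigma>2 where 2: "(l2, r2) \<in> R2" "q \<in> poss u" "subt_at u q = subst l2 \<sigma>2"
    "t = replace_at u q (subst r2 \<sigma>2)" using assms(2) by (rule rstep_atE)
  note par = parallel_replace_at[OF assms(3) 1(2) 2(2)]
    and par' = parallel_replace_at[OF parallel_pos_sym[OF assms(3)] 2(2) 1(2)]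
  let ?w = "replace_at s q (subst r2 \<sigma>2)"
  have "(s, ?w) \<in> rstep_at R2 q" unfolding rstep_at_def using 1 2 par by auto
  moreover have "(t, ?w) \<in> rstep_at R1 p" unfolding rstep_at_def using 1 2 par par' by auto
  ultimately show thesis using that rstep_iff_rstep_at by blast
qed

text \<open>Primality as a property of the contracted subterm alone, so that it applies to arbitrary
  steps and not only to most general instances.\<close>

definition prime_at :: "('f, 'v) rule set \<Rightarrow> ('f, 'v) trm \<Rightarrow> bool" where
  "prime_at R t \<longleftrightarrow> (\<forall>q \<in> poss t. q \<noteq> [] \<longrightarrow> NF R (subt_at t q))"

text \<open>A redex inside \<open>t\<close> remains one under \<open>\<sigma>\<close>. Primality
  therefore passes from an arbitrary overlap down to its most general form.\<close>

lemma prime_at_subst: "prime_at R (subst t \<sigma>) \<Longrightarrow> prime_at R t"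
  unfolding prime_at_def by (metis NF_subst poss_subst subt_at_subst)

lemma not_prime_at_innermost:
  assumes "\<not> prime_at R t"
  obtains q s where "q \<noteq> []" "(t, s) \<in> rstep_at R q" "prime_at R (subt_at t q)"
proof -
  define P where "P q \<longleftrightarrow> q \<noteq> [] \<and> (\<exists>s. (t, s) \<in> rstep_at R q)" for q
  \<comment> \<open>A reducible subterm need not be a redex itself, but it has one at some extension
    of its position.\<close>
  have extend: "\<exists>r. P (q @ r)" if q: "q \<in> poss t" "q \<noteq> []" "\<not> NF R (subt_at t q)" for q
  proof -
    obtain s r where "(subt_at t q, s) \<in> rstep_at R r"
      using q(3) by (auto simp: NF_def rstep_iff_rstep_at)
    then obtain l rr \<sigma> where "(l, rr) \<in> R" "r \<in> poss (subt_at t q)" "subt_at (subt_at t q) r = subst l \<sigma>"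
      by (rule rstep_atE)
    then have "(t, replace_at t (q @ r) (subst rr \<sigma>)) \<in> rstep_at R (q @ r)"
      unfolding rstep_at_def using q(1) by (auto simp: poss_append subt_at_append)
    then show ?thesis using q(2) by (auto simp: P_def)
  qed
  have "\<exists>q. P q" using assms extend unfolding prime_at_def by blast
  \<comment> \<open>An innermost redex is found by minimizing the size of the subterm; a redex
    strictly below \<open>q\<close> would have a smaller one.\<close>
  then obtain q where q: "P q" and min: "\<And>q'. P q' \<Longrightarrow> size (subt_at t q) \<le> size (subt_at t q')"
    using ex_has_least_nat[of P _ "\<lambda>q. size (subt_at t q)"] by blast
  obtain s where s: "(t, s) \<in> rstep_at R q" using q by (auto simp: P_def)
  then have qt: "q \<in> poss t" by (rule rstep_atE)
  have "prime_at R (subt_at t q)"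
    unfolding prime_at_def
  proof (intro ballI impI, rule ccontr)
    fix r
    assume r: "r \<in> poss (subt_at t q)" "r \<noteq> []" "\<not> NF R (subt_at (subt_at t q) r)"
    have qr: "q @ r \<in> poss t" using r qt by (simp add: poss_append)
    obtain r' where r': "P ((q @ r) @ r')"
      using extend[OF qr] r qt by (auto simp: subt_at_append)
    then have "(q @ r) @ r' \<in> poss t" by (auto simp: P_def elim: rstep_atE)
    then have "r @ r' \<in> poss (subt_at t q)" using qt by (simp add: poss_append)
    then have "size (subt_at (subt_at t q) (r @ r')) < size (subt_at t q)"
      using r(2) by (intro size_subt_at) simp_all
    then show False using min[OF r'] qt by (simp add: subt_at_append)
  qed
  then show thesis using that s q by (auto simp: P_def)
qed

section \<open>Overlaps and critical pairs\<close>

lemma renaming_apart: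
  assumes "infinite (UNIV :: 'v set)" "finite (A :: 'v set)" "finite C"
  obtains \<pi> :: "'v \<Rightarrow> 'v" where "bij \<pi>" "\<pi> ` A \<inter> C = {}"
proof -
  have "infinite (UNIV - (A \<union> C))" using assms by simp
  then obtain D where D: "finite D" "card D = card A" "D \<subseteq> UNIV - (A \<union> C)"
    using infinite_arbitrarily_large by metis
  obtain f where f: "bij_betw f A D"
    using finite_same_card_bij[of A D] assms(2) D by auto
  \<comment> \<open>\<open>variant\<close> asks for a bijection on all variables, so
    \<open>\<pi>\<close> swaps \<open>A\<close> with the fresh set \<open>D\<close> and fixes the
    rest; being an involution, it is bijective.\<close>
  define \<pi> where "\<pi> x = (if x \<in> A then f x else if x \<in> D then inv_into A f x else x)" for x
  have "\<pi> (\<pi> x) = x" for x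
  proof -
    have "f x \<in> D \<and> inv_into A f (f x) = x" if "x \<in> A"
      using f that by (simp add: bij_betw_apply bij_betw_inv_into_left)
    moreover have "inv_into A f x \<in> A \<and> f (inv_into A f x) = x" if "x \<in> D"
      using f that by (simp add: bij_betw_apply[OF bij_betw_inv_into] bij_betw_inv_into_right)
    moreover have "A \<inter> D = {}" using D(3) by blast
    ultimately show ?thesis unfolding \<pi>_def by auto
  qed
  then have "bij \<pi>" by (intro o_bij[of \<pi>]) auto
  moreover have "\<pi> ` A \<inter> C = {}"
    using D(3) bij_betw_apply[OF f] by (auto simp: \<pi>_def)
  ultimately show thesis by (rule that)
qed

lemma subst_inv_renaming: "bij \<pi> \<Longrightarrow> subst (subst t (Var \<circ> \<pi>)) (\<lambda>x. \<sigma> (inv \<pi> x)) = subst t \<sigma>"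
  by (simp add: subst_subst bij_is_inj)

lemma variant_trans:
  assumes "variant \<rho>1 \<rho>2" "variant \<rho>2 \<rho>3"
  shows "variant \<rho>1 \<rho>3"
proof -
  obtain \<pi>1 \<pi>2 where *: "bij \<pi>1" "bij \<pi>2"
    "fst \<rho>2 = subst (fst \<rho>1) (Var \<circ> \<pi>1)" "snd \<rho>2 = subst (snd \<rho>1) (Var \<circ> \<pi>1)"
    "fst \<rho>3 = subst (fst \<rho>2) (Var \<circ> \<pi>2)" "snd \<rho>3 = subst (snd \<rho>2) (Var \<circ> \<pi>2)"
    using assms unfolding variant_def by blast
  then show ?thesis unfolding variant_def
    by (intro exI[of _ "\<pi>2 \<circ> \<pi>1"]) (auto simp: subst_subst bij_comp intro!: subst_cong)
qed

lemma variant_refl: "variant \<rho> \<rho>"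
  unfolding variant_def by (intro exI[of _ id]) (simp add: comp_def)

lemma PCP_genI:
  "overlap R1 R2 \<rho>1 p \<rho>2 \<Longrightarrow> is_mgu \<sigma> (fst \<rho>1) (subt_at (fst \<rho>2) p) \<Longrightarrow>
    prime_at R (subt_at (subst (fst \<rho>2) \<sigma>) p) \<Longrightarrow>
    (replace_at (subst (fst \<rho>2) \<sigma>) p (subst (snd \<rho>1) \<sigma>), subst (snd \<rho>2) \<sigma>) \<in> PCP_gen R R1 R2"
  unfolding PCP_gen_def prime_at_def by blast

text \<open>After renaming the first rule apart, the two matching substitutions merge into one
  unifier, which factors through an mgu; the remaining factor \<open>\<delta>\<close> exhibits the
  peak as an instance of a critical one.\<close>

lemma PCP_gen_instance:
  fixes R1 R2 :: "('f, 'v) rule set"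
  assumes inf: "infinite (UNIV :: 'v set)"
    and rules: "(l1, r1) \<in> R1" "(l2, r2) \<in> R2"
    and p: "p \<in> poss l2" "\<nexists>x. subt_at l2 p = Var x"
    and eq: "subst (subt_at l2 p) \<sigma>2 = subst l1 \<sigma>1"
    and prime: "prime_at R (subst l1 \<sigma>1)"
    and not_variant: "p = [] \<Longrightarrow> \<not> variant (l1, r1) (l2, r2)"
  obtains s t \<delta> where "(s, t) \<in> PCP_gen R R1 R2"
    "replace_at (subst l2 \<sigma>2) p (subst r1 \<sigma>1) = subst s \<delta>" "subst r2 \<sigma>2 = subst t \<delta>"
proof -
  obtain \<pi> where \<pi>: "bij \<pi>" "\<pi> ` rule_vars (l1, r1) \<inter> rule_vars (l2, r2) = {}"
    using renaming_apart[OF inf, of "rule_vars (l1, r1)" "rule_vars (l2, r2)"] by (auto simp: rule_vars_def)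
  define m1 n1 where "m1 = subst l1 (Var \<circ> \<pi>)" and "n1 = subst r1 (Var \<circ> \<pi>)"
  have rv: "rule_vars (m1, n1) = \<pi> ` rule_vars (l1, r1)"
    by (auto simp: rule_vars_def m1_def n1_def vars_subst)
  have var1: "variant (l1, r1) (m1, n1)"
    unfolding variant_def m1_def n1_def using \<pi>(1) by auto
  \<comment> \<open>On the renamed variables \<open>inv \<pi>\<close> undoes the renaming before
    \<open>\<sigma>1\<close> acts; elsewhere \<open>\<sigma>2\<close> acts.\<close>
  define \<tau> where "\<tau> x = (if x \<in> rule_vars (m1, n1) then \<sigma>1 (inv \<pi> x) else \<sigma>2 x)" for x
  have "subst m1 \<tau> = subst m1 (\<lambda>x. \<sigma>1 (inv \<pi> x))" "subst n1 \<tau> = subst n1 (\<lambda>x. \<sigma>1 (inv \<pi> x))"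
    by (auto simp: \<tau>_def rule_vars_def intro!: subst_cong)
  then have \<tau>1: "subst m1 \<tau> = subst l1 \<sigma>1" "subst n1 \<tau> = subst r1 \<sigma>1"
    using subst_inv_renaming[OF \<pi>(1)] by (simp_all add: m1_def n1_def)
  have \<tau>2: "subst l2 \<tau> = subst l2 \<sigma>2" "subst r2 \<tau> = subst r2 \<sigma>2"
    using \<pi>(2) unfolding rv[symmetric] by (auto simp: \<tau>_def rule_vars_def intro!: subst_cong)
  have \<tau>p: "subst (subt_at l2 p) \<tau> = subst (subt_at l2 p) \<sigma>2"
    using \<tau>2(1) p(1) by (simp add: subt_at_subst[symmetric])
  have unif: "subst m1 \<tau> = subst (subt_at l2 p) \<tau>" by (simp add: \<tau>1 \<tau>p eq)
  obtain \<mu> where \<mu>: "is_mgu \<mu> m1 (subt_at l2 p)" using is_mgu_exists[OF unif] by blast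
  obtain \<delta> where \<delta>: "\<And>x. \<tau> x = subst (\<mu> x) \<delta>" using \<mu> unif unfolding is_mgu_def by blast
  have inst: "subst t \<tau> = subst (subst t \<mu>) \<delta>" for t
    unfolding subst_subst \<delta>[symmetric] ..
  \<comment> \<open>Variants compose, so the exclusion of variants at the root carries over to the
    renamed rule.\<close>
  have ov: "overlap R1 R2 (m1, n1) p (l2, r2)"
    unfolding overlap_def
    using rules var1 variant_refl \<pi>(2)[folded rv] p unif not_variant variant_trans[OF var1]
    by auto
  have "prime_at R (subst (subt_at l2 p) \<mu>)"
    by (rule prime_at_subst[of _ _ \<delta>]) (use prime in \<open>simp add: inst[symmetric] \<tau>p eq\<close>)
  then have "(replace_at (subst l2 \<mu>) p (subst n1 \<mu>), subst r2 \<mu>) \<in> PCP_gen R R1 R2"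
    using PCP_genI[OF ov, of \<mu> R] \<mu> p(1) by (simp add: subt_at_subst)
  then show thesis
    by (rule that[of _ _ \<delta>]) (use p(1) in \<open>simp_all add: subst_replace_at poss_subst inst[symmetric] \<tau>1 \<tau>2\<close>)
qed

text \<open>The case analysis of the critical pair lemma. The second case is the root overlap that
  \<open>overlap\<close> excludes; the third places the inner step in the value of a single
  variable.\<close>

lemma nested_rstep_at_cases:
  fixes R1 R2 :: "('f, 'v) rule set"
  assumes inf: "infinite (UNIV :: 'v set)"
    and inner: "(u, s) \<in> rstep_at R1 (p @ q)" and outer: "(u, t) \<in> rstep_at R2 p"
    and prime: "prime_at R (subt_at u (p @ q))"
  obtains
    (critical) "(s, t) \<in> rstep (PCP_gen R R1 R2)"
  | (variant) l1 r1 l2 r2 \<sigma>1 \<sigma>2 where "(l1, r1) \<in> R1" "(l2, r2) \<in> R2" "variant (l1, r1) (l2, r2)"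
      "subst l1 \<sigma>1 = subst l2 \<sigma>2" "s = replace_at u p (subst r1 \<sigma>1)" "t = replace_at u p (subst r2 \<sigma>2)"
  | (variable) l r x q' \<sigma> \<sigma>' where "(l, r) \<in> R2" "p \<in> poss u" "u = replace_at u p (subst l \<sigma>)"
      "t = replace_at u p (subst r \<sigma>)" "s = replace_at u p (replace_at (subst l \<sigma>) q' (\<sigma>' x))"
      "q' \<in> poss l" "subt_at l q' = Var x" "(\<sigma> x, \<sigma>' x) \<in> rstep R1" "\<And>y. y \<noteq> x \<Longrightarrow> \<sigma>' y = \<sigma> y"
proof -
  obtain l1 r1 \<sigma>1 where 1: "(l1, r1) \<in> R1" "p @ q \<in> poss u" "subt_at u (p @ q) = subst l1 \<sigma>1"
    "s = replace_at u (p @ q) (subst r1 \<sigma>1)" using inner by (rule rstep_atE)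
  obtain l2 r2 \<sigma>2 where 2: "(l2, r2) \<in> R2" "p \<in> poss u" "subt_at u p = subst l2 \<sigma>2"
    "t = replace_at u p (subst r2 \<sigma>2)" using outer by (rule rstep_atE)
  have q: "q \<in> poss (subst l2 \<sigma>2)" using 1(2) 2(2,3) by (simp add: poss_append)
  have eq: "subt_at (subst l2 \<sigma>2) q = subst l1 \<sigma>1" using 1(3) 2(2,3) by (simp add: subt_at_append)
  have s: "s = replace_at u p (replace_at (subst l2 \<sigma>2) q (subst r1 \<sigma>1))"
    using 1(4) 2(2,3) by (simp add: replace_at_append)
  from q show thesis
  proof (cases rule: poss_subst_cases)
    case inside
    show thesis
    proof (cases "q = [] \<and> Defs.variant (l1, r1) (l2, r2)")
      case True
      then show thesis using variant[OF 1(1) 2(1) _ _ _ 2(4)] eq s by simp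
    next
      case False
      have "subst (subt_at l2 q) \<sigma>2 = subst l1 \<sigma>1" using eq inside by (simp add: subt_at_subst)
      moreover have "prime_at R (subst l1 \<sigma>1)" using prime 1(3) by simp
      ultimately obtain a b \<delta> where "(a, b) \<in> PCP_gen R R1 R2"
        "replace_at (subst l2 \<sigma>2) q (subst r1 \<sigma>1) = subst a \<delta>" "subst r2 \<sigma>2 = subst b \<delta>"
        using PCP_gen_instance[OF inf 1(1) 2(1) inside] False by metis
      then have "(s, t) \<in> rstep (PCP_gen R R1 R2)" using rstepI[of a b _ p u \<delta>] 2(2,4) s by simp
      then show thesis by (rule critical)
    qed
  next
    case (var q1 q2 x)
    \<comment> \<open>The updated substitution changes every occurrence of \<open>x\<close>, whereas
      \<open>s\<close> changes only the one at \<open>q1\<close>.\<close>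
    let ?\<sigma>' = "\<sigma>2(x := replace_at (\<sigma>2 x) q2 (subst r1 \<sigma>1))"
    have sub: "subt_at (subst l2 \<sigma>2) q1 = \<sigma>2 x" using var by (simp add: subt_at_subst)
    have q1: "q1 \<in> poss (subst l2 \<sigma>2)" using var by (simp add: poss_subst)
    have "subt_at (\<sigma>2 x) q2 = subst l1 \<sigma>1" using eq q1 sub var(1) by (simp add: subt_at_append)
    then have step: "(\<sigma>2 x, ?\<sigma>' x) \<in> rstep R1"
      using rstepI[OF 1(1) var(4), of \<sigma>1] replace_at_subt_at[OF var(4)] by simp
    have s': "s = replace_at u p (replace_at (subst l2 \<sigma>2) q1 (?\<sigma>' x))"
      using s q1 sub var(1) by (simp add: replace_at_append)
    show thesis
      using variable[where \<sigma> = \<sigma>2 and \<sigma>' = ?\<sigma>', OF 2(1,2) _ 2(4) s' var(2,3) step] 2(2,3)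
        replace_at_subt_at[of p u] by simp
  qed
qed

section \<open>Conversions below a term\<close>

text \<open>Both ends of every step are bounded by \<open>u\<close>, yet the closure relates each
  term to itself even outside the bound, so equal reducts are connected without any order
  argument.\<close>

definition below :: "'a rel \<Rightarrow> 'a rel \<Rightarrow> 'a \<Rightarrow> 'a rel" where
  "below gt S u = (S \<inter> gt `` {u} \<times> gt `` {u})\<^sup>*"

lemma below_refl [simp]: "(a, a) \<in> below gt S u"
  by (simp add: below_def)

lemma below_step: "(a, b) \<in> S \<Longrightarrow> (u, a) \<in> gt \<Longrightarrow> (u, b) \<in> gt \<Longrightarrow> (a, b) \<in> below gt S u"
  by (auto simp: below_def)

lemma below_trans: "(a, b) \<in> below gt S u \<Longrightarrow> (b, c) \<in> below gt S u \<Longrightarrow> (a, c) \<in> below gt S u"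
  by (auto simp: below_def)

lemma below_sym:
  assumes "sym S" "(a, b) \<in> below gt S u"
  shows "(b, a) \<in> below gt S u"
proof -
  have "sym (below gt S u)"
    unfolding below_def by (rule sym_rtrancl) (use assms(1) in \<open>auto simp: sym_def\<close>)
  then show ?thesis using assms(2) by (rule symD)
qed

lemma below_mono: "gt `` {u} \<subseteq> gt `` {v} \<Longrightarrow> (a, b) \<in> below gt S u \<Longrightarrow> (a, b) \<in> below gt S v"
  unfolding below_def by (erule rtrancl_mono[THEN subsetD, rotated]) auto

text \<open>If \<open>T\<close> preserves lying below \<open>u\<close>, only the start has to be
  checked; this serves rewrite sequences and \<open>B\<close>-conversions alike.\<close>

lemma below_rtrancl:
  assumes "(a, b) \<in> T\<^sup>*" "(u, a) \<in> gt" "T \<subseteq> S" "\<And>x y. (u, x) \<in> gt \<Longrightarrow> (x, y) \<in> T \<Longrightarrow> (u, y) \<in> gt"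
  shows "(a, b) \<in> below gt S u"
proof -
  from assms(1) have "(a, b) \<in> below gt S u \<and> (u, b) \<in> gt"
  proof (induction rule: rtrancl_induct)
    case base
    then show ?case using assms(2) by simp
  next
    case (step y z)
    have "(u, z) \<in> gt" using step assms(4) by blast
    moreover have "(y, z) \<in> below gt S u" using step assms(3) calculation by (intro below_step) auto
    ultimately show ?case using step below_trans by metis
  qed
  then show ?thesis by simp
qed

text \<open>An \<open>S\<close>-step does not decrease, so a cliff must be answered by a genuine
  \<open>R\<close>-step out of \<open>t\<close>. Such steps can be carried through the whole
  \<open>S\<close>-class of \<open>u\<close>, and what remains lies strictly below \<open>u\<close>,
  where the induction hypothesis applies.\<close>

lemma peaks_cliffs_imp_Church_Rosser:
  fixes R S gt :: "'a rel"
  defines "W \<equiv> R \<union> R\<inverse> \<union> S"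
  assumes wf: "wf (gt\<inverse>)" and trans: "trans gt" and R_gt: "R \<subseteq> gt" and S: "sym S"
    and compat: "S\<^sup>* O gt O S\<^sup>* \<subseteq> gt"
    and peak: "\<And>u s t. (u, s) \<in> R \<Longrightarrow> (u, t) \<in> R \<Longrightarrow> (s, t) \<in> below gt W u"
    and cliff: "\<And>u s t. (u, s) \<in> R \<Longrightarrow> (u, t) \<in> S \<Longrightarrow> \<exists>s'. (t, s') \<in> R \<and> (s', s) \<in> below gt W u"
  shows "W\<^sup>* \<subseteq> R\<^sup>* O S\<^sup>* O (R\<inverse>)\<^sup>*"
proof -
  define J where "J = R\<^sup>* O S\<^sup>* O (R\<inverse>)\<^sup>*"
  have symW: "sym W" using S by (auto simp: W_def sym_def)
  have symS: "(b, a) \<in> S\<^sup>*" if "(a, b) \<in> S\<^sup>*" for a b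
    using sym_rtrancl[OF S] that by (rule symD)
  have J_iff: "(a, b) \<in> J \<longleftrightarrow> (\<exists>c d. (a, c) \<in> R\<^sup>* \<and> (c, d) \<in> S\<^sup>* \<and> (b, d) \<in> R\<^sup>*)" for a b
    unfolding J_def by (auto simp: rtrancl_converse)
  have J_sym: "(b, a) \<in> J" if "(a, b) \<in> J" for a b
    using that symS unfolding J_iff by blast
  have R_J: "(a, b) \<in> J" if "(a, c) \<in> R\<^sup>*" "(c, b) \<in> J" for a b c
    using that unfolding J_iff by (meson rtrancl_trans)
  have S_J: "(a, b) \<in> J" if "(a, b) \<in> S\<^sup>*" for a b
    using that unfolding J_iff by blast
  \<comment> \<open>\<open>L u\<close> is exactly what prolongs a joined conversion ending in
    \<open>u\<close> by one step to \<open>s\<close>: \<open>u\<close> reduces to \<open>w\<close>,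
    which is \<open>S\<close>-equivalent to \<open>v\<close> on the other side of the join.\<close>
  define L where "L u \<longleftrightarrow> (\<forall>s w v. (u, s) \<in> W \<longrightarrow> (u, w) \<in> R\<^sup>* \<longrightarrow> (w, v) \<in> S\<^sup>* \<longrightarrow> (s, v) \<in> J)" for u
  \<comment> \<open>The set \<open>P\<close> is the cone below \<open>u\<close> inside the induction
    and the set of all terms at the end.\<close>
  have chain: "(a, b) \<in> J" if ab: "(a, b) \<in> (W \<inter> P \<times> P)\<^sup>*" and P: "\<And>x. x \<in> P \<Longrightarrow> L x" for a b P
    using ab
  proof (induction rule: rtrancl_induct)
    case base
    show ?case by (rule S_J) simp
  next
    case (step y z)
    obtain c d where cd: "(a, c) \<in> R\<^sup>*" "(c, d) \<in> S\<^sup>*" "(y, d) \<in> R\<^sup>*" using step.IH unfolding J_iff by blast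
    have "L y" "(y, z) \<in> W" using step(2) P by auto
    then have "(z, c) \<in> J" using cd symS unfolding L_def by blast
    then show ?case using R_J[OF cd(1)] J_sym by blast
  qed
  have gt_S: "(u, y) \<in> gt" if "(u, x) \<in> gt" "(x, y) \<in> S\<^sup>*" for u x y
    using compat that by blast
  have S_gt: "(u, y) \<in> gt" if "(u, x) \<in> S\<^sup>*" "(x, y) \<in> gt" for u x y
    using compat that by blast
  have gt_R: "(u, y) \<in> gt" if "(u, x) \<in> gt" "(x, y) \<in> R" for u x y
    using trans R_gt that by (meson subsetD transD)
  have "L u" for u
    using wf
  proof (induction u rule: wf_induct_rule)
    case (less u)
    have below_J: "(a, b) \<in> J" if "(a, b) \<in> below gt W u" for a b
      using chain[of a b "gt `` {u}"] that less unfolding below_def by auto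
    \<comment> \<open>Once a first \<open>R\<close>-step has left \<open>u\<close>, the rest of the
      path to \<open>v\<close> stays below \<open>u\<close>.\<close>
    have tail: "(u1, v) \<in> below gt W u" if "(u, u1) \<in> R" "(u1, w) \<in> R\<^sup>*" "(w, v) \<in> S\<^sup>*" for u1 w v
    proof -
      have "(u, u1) \<in> gt" using that(1) R_gt by blast
      have w: "(u, w) \<in> gt"
        using that(2) \<open>(u, u1) \<in> gt\<close> by (induction rule: rtrancl_induct) (auto intro: gt_R)
      have "(u1, w) \<in> below gt W u"
        using that(2) \<open>(u, u1) \<in> gt\<close> by (rule below_rtrancl) (auto simp: W_def intro: gt_R)
      moreover have "(w, v) \<in> below gt W u"
        using that(3) w by (rule below_rtrancl) (auto simp: W_def intro: gt_S)
      ultimately show ?thesis by (rule below_trans)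
    qed
    \<comment> \<open>Each \<open>S\<close>-step hands the \<open>R\<close>-step on to the next
      member of the class; by compatibility a bound by that member is also a bound by
      \<open>u\<close>.\<close>
    have transport: "\<exists>s'. (v, s') \<in> R \<and> (s', s) \<in> below gt W u" if "(u, s) \<in> R" "(u, v) \<in> S\<^sup>*" for s v
      using that(2)
    proof (induction rule: rtrancl_induct)
      case base
      show ?case using that(1) below_refl by metis
    next
      case (step y z)
      then obtain s1 where s1: "(y, s1) \<in> R" "(s1, s) \<in> below gt W u" by blast
      obtain s2 where s2: "(z, s2) \<in> R" "(s2, s1) \<in> below gt W y" using cliff[OF s1(1) step(2)] by blast
      have "(s2, s1) \<in> below gt W u" by (rule below_mono[OF _ s2(2)]) (auto intro: S_gt[OF step(1)])
      then show ?case using s1 s2 below_trans by metis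
    qed
    show "L u"
      unfolding L_def
    proof (intro allI impI)
      fix s w v
      assume us: "(u, s) \<in> W" and uw: "(u, w) \<in> R\<^sup>*" and wv: "(w, v) \<in> S\<^sup>*"
      from us consider "(s, u) \<in> R" | "(u, s) \<in> R" | "(u, s) \<in> S" by (auto simp: W_def)
      then show "(s, v) \<in> J"
      proof cases
        case 1
        then show ?thesis using uw wv R_J[of s w v] S_J by (meson converse_rtrancl_into_rtrancl)
      next
        case 2
        from uw show ?thesis
        proof (cases rule: converse_rtranclE)
          case base
          \<comment> \<open>Here \<open>w = u\<close>, so the step to \<open>s\<close> is carried
            along the \<open>S\<close>-conversion to a step out of \<open>v\<close>.\<close>
          then obtain s' where "(v, s') \<in> R" "(s', s) \<in> below gt W u" using transport[OF 2] wv by blast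
          then show ?thesis using below_J J_sym R_J by (meson r_into_rtrancl)
        next
          case (step u1)
          then show ?thesis using peak[OF 2] tail[OF _ _ wv] below_trans below_J by metis
        qed
      next
        case 3
        from uw show ?thesis
        proof (cases rule: converse_rtranclE)
          case base
          have "(s, u) \<in> S" using S 3 by (rule symD)
          then have "(s, v) \<in> S\<^sup>*" using wv base by (simp add: converse_rtrancl_into_rtrancl)
          then show ?thesis by (rule S_J)
        next
          case (step u1)
          \<comment> \<open>The cliff at \<open>u\<close> yields a step out of \<open>s\<close>;
            from its target on, the path through \<open>u1\<close> to \<open>v\<close> is below
            \<open>u\<close>.\<close>
          obtain s' where "(s, s') \<in> R" "(s', u1) \<in> below gt W u" using cliff[OF step(1) 3] by blast
          then show ?thesis using tail[OF step wv] below_trans below_J R_J by (meson r_into_rtrancl)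
        qed
      qed
    qed
  qed
  then show ?thesis using chain[of _ _ UNIV] unfolding J_def by auto
qed

section \<open>Compatible reduction orders\<close>

text \<open>Instantiated with the final rules to speak about \<open>conv_below\<close>, and with
  intermediate rule sets to obtain order facts.\<close>

locale compatible_trs =
  fixes R B :: "('f, 'v) rule set" and gt :: "('f, 'v) trm rel"
  assumes order: "B_compatible_reduction_order B gt"
    and R_gt: "R \<subseteq> gt"
begin

abbreviation conv_below :: "('f, 'v) trm \<Rightarrow> ('f, 'v) trm rel" where
  "conv_below \<equiv> below gt (sstep (R \<union> B))"

lemma gt_trans: "(a, b) \<in> gt \<Longrightarrow> (b, c) \<in> gt \<Longrightarrow> (a, c) \<in> gt"
  using order unfolding B_compatible_reduction_order_def by (meson transD)

lemma gt_irrefl: "(a, a) \<notin> gt"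
  using order unfolding B_compatible_reduction_order_def by (meson irreflD)

lemma gt_no_chain: "\<not> (\<forall>i. (f i, f (Suc i)) \<in> gt)"
  using order unfolding B_compatible_reduction_order_def SN_rel_def by blast

lemma wf_gt: "wf (gt\<inverse>)"
  using gt_no_chain by (simp add: wf_iff_no_infinite_down_chain)

lemma gt_simB: "(a, b) \<in> gt \<Longrightarrow> (b, c) \<in> simB B \<Longrightarrow> (a, c) \<in> gt"
  using order simB_refl[of a B] unfolding B_compatible_reduction_order_def by blast

lemma simB_gt: "(a, b) \<in> simB B \<Longrightarrow> (b, c) \<in> gt \<Longrightarrow> (a, c) \<in> gt"
  using order simB_refl[of c B] unfolding B_compatible_reduction_order_def by blast

lemma rewrite_closed_gt: "rewrite_closed gt"
  using order unfolding B_compatible_reduction_order_def by (intro rewrite_closedI) simp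

lemma rstep_gt: "(a, b) \<in> rstep R \<Longrightarrow> (a, b) \<in> gt"
  using rstep_least[OF rewrite_closed_gt R_gt] by blast

lemma rsteps_gt: "(a, b) \<in> (rstep R)\<^sup>* \<Longrightarrow> (u, a) \<in> gt \<Longrightarrow> (u, b) \<in> gt"
  by (induction rule: rtrancl_induct) (auto intro: gt_trans rstep_gt)

lemma rel_mod_gt: "(a, b) \<in> rel_mod R B \<Longrightarrow> (a, b) \<in> gt"
  unfolding rel_mod_def by (meson relcompEpair gt_simB simB_gt rstep_gt)

lemma terminating: "terminating_mod R B"
  using gt_no_chain rel_mod_gt unfolding terminating_mod_def SN_rel_def by blast

lemma conv_below_sym: "(a, b) \<in> conv_below u \<Longrightarrow> (b, a) \<in> conv_below u"
  by (rule below_sym[OF sym_sstep])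

lemma conv_below_gt: "(v, u) \<in> gt \<Longrightarrow> (a, b) \<in> conv_below u \<Longrightarrow> (a, b) \<in> conv_below v"
  by (erule below_mono[rotated]) (auto intro: gt_trans)

lemma conv_below_simB: "(v, u) \<in> simB B \<Longrightarrow> (a, b) \<in> conv_below u \<Longrightarrow> (a, b) \<in> conv_below v"
  by (erule below_mono[rotated]) (auto intro: simB_gt)

lemma rsteps_below: "(a, b) \<in> (rstep R)\<^sup>* \<Longrightarrow> (u, a) \<in> gt \<Longrightarrow> (a, b) \<in> conv_below u"
  by (erule below_rtrancl) (auto simp: sstep_def rstep_Un intro: gt_trans rstep_gt)

lemma rstep_below: "(a, b) \<in> rstep R \<Longrightarrow> (u, a) \<in> gt \<Longrightarrow> (a, b) \<in> conv_below u"
  by (rule rsteps_below) auto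

lemma simB_below: "(a, b) \<in> simB B \<Longrightarrow> (u, a) \<in> gt \<Longrightarrow> (a, b) \<in> conv_below u"
  unfolding simB_def conv_def
  by (erule below_rtrancl) (auto simp: sstep_Un intro: gt_simB sstep_simB)

text \<open>The variable condition follows from well-foundedness: if \<open>y\<close> occurred only
  in \<open>r\<close>, instantiating \<open>y\<close> by \<open>l\<close> would put \<open>l\<close>
  above a context filled with \<open>l\<close>, and iterating that context would descend
  forever.\<close>

lemma rule_vars_subset:
  assumes "(l, r) \<in> gt"
  shows "vars r \<subseteq> vars l"
proof (rule ccontr)
  assume "\<not> vars r \<subseteq> vars l"
  then obtain y where y: "y \<in> vars r" "y \<notin> vars l" by blast
  obtain p where p: "p \<in> poss r" "subt_at r p = Var y" using vars_obtain_pos[OF y(1)] .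
  let ?r = "subst r (Var(y := l))"
  have pr: "p \<in> poss ?r" using p(1) by (rule poss_subst)
  have "subst l (Var(y := l)) = subst l Var" by (rule subst_cong) (use y(2) in auto)
  then have "(l, ?r) \<in> gt" using rewrite_closed_subst[OF rewrite_closed_gt assms, of "Var(y := l)"] by simp
  moreover have "replace_at ?r p l = ?r"
    using replace_at_subt_at[OF pr] p by (simp add: subt_at_subst)
  ultimately have "(l, replace_at ?r p l) \<in> gt" by simp
  have "\<forall>i. ((replace_at ?r p ^^ i) l, (replace_at ?r p ^^ Suc i) l) \<in> gt"
  proof
    fix i
    show "((replace_at ?r p ^^ i) l, (replace_at ?r p ^^ Suc i) l) \<in> gt"
    proof (induction i)
      case 0
      show ?case using \<open>(l, replace_at ?r p l) \<in> gt\<close> by (simp del: fun_upd_apply)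
    next
      case (Suc i)
      then show ?case
        using rewrite_closed_ctxt[OF rewrite_closed_gt Suc pr] by (simp only: funpow.simps comp_apply)
    qed
  qed
  then show False by (rule notE[OF gt_no_chain])
qed

end

text \<open>The critical assumptions concern instances in contexts. For cliffs the closure is
  symmetric, because overlaps of \<open>R\<close> into \<open>B\<close> list the
  \<open>R\<close>-reduct first and overlaps of \<open>B\<close> into \<open>R\<close> list it
  second.\<close>

locale fair_trs = compatible_trs R B gt
  for R B :: "('f, 'v) rule set" and gt :: "('f, 'v) trm rel" +
  assumes inf: "infinite (UNIV :: 'v set)"
    and B_vars: "\<forall>(l, r) \<in> B. vars l = vars r"
    and ll: "left_linear R"
    and critical_peak: "\<And>u s t. (s, t) \<in> rstep (PCP R) \<Longrightarrow> (u, s) \<in> rstep R \<Longrightarrow> (u, t) \<in> rstep R \<Longrightarrow>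
      (s, t) \<in> conv_below u"
    and critical_cliff: "\<And>u s t. (s, t) \<in> sstep (PCP_pm R B) \<Longrightarrow> (u, s) \<in> rstep R \<Longrightarrow> (u, t) \<in> sstep B \<Longrightarrow>
      \<exists>s'. (t, s') \<in> rstep R \<and> (s', s) \<in> conv_below u"
begin

lemma Bpm_vars: "(l, r) \<in> Bpm B \<Longrightarrow> vars l = vars r"
  using B_vars by (auto simp: Bpm_def)

lemma Bpm_step: "(s, t) \<in> rstep_at (Bpm B) p \<Longrightarrow> (s, t) \<in> sstep B"
  unfolding rstep_Bpm[symmetric] rstep_iff_rstep_at by blast

text \<open>A common instance would make its left side both greater than and
  \<open>B\<close>-equivalent to its right side. This removes the variant case from cliffs.\<close>

lemma not_variant_R_B:
  assumes "(l1, r1) \<in> R" "(l2, r2) \<in> Bpm B" "variant (l1, r1) (l2, r2) \<or> variant (l2, r2) (l1, r1)"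
  shows False
proof -
  have B: "(subst l2 \<sigma>, subst r2 \<sigma>) \<in> simB B" for \<sigma>
    using rstep_root[OF assms(2)] unfolding rstep_Bpm by (rule sstep_simB)
  have R: "(subst l1 \<sigma>, subst r1 \<sigma>) \<in> gt" for \<sigma>
    using rewrite_closed_subst[OF rewrite_closed_gt] assms(1) R_gt by blast
  from assms(3) have "\<exists>\<sigma>. subst l1 \<sigma> = l2 \<and> subst r1 \<sigma> = r2 \<or> subst l2 \<sigma> = l1 \<and> subst r2 \<sigma> = r1"
    unfolding variant_def by auto
  then have "\<exists>\<sigma> \<tau>. subst l1 \<sigma> = subst l2 \<tau> \<and> subst r1 \<sigma> = subst r2 \<tau>"
    by (metis subst_Var)
  then show False using B R gt_simB gt_irrefl simB_sym by metis
qed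

section \<open>Prime peaks and cliffs\<close>

lemma prime_peak:
  assumes inner: "(u, s) \<in> rstep_at R (p @ q)" and outer: "(u, t) \<in> rstep_at R p"
    and prime: "prime_at R (subt_at u (p @ q))"
  shows "(s, t) \<in> conv_below u"
proof -
  have us: "(u, s) \<in> rstep R" and ut: "(u, t) \<in> rstep R"
    using inner outer rstep_iff_rstep_at by blast+
  from inf inner outer prime show ?thesis
  proof (cases rule: nested_rstep_at_cases)
    case critical
    then show ?thesis using critical_peak us ut by (simp add: PCP_def)
  next
    case (variant l1 r1 l2 r2 \<sigma>1 \<sigma>2)
    then obtain \<pi> where \<pi>: "l2 = subst l1 (Var \<circ> \<pi>)" "r2 = subst r1 (Var \<circ> \<pi>)"
      unfolding variant_def by auto
    \<comment> \<open>Agreement on the left-hand side determines the right-hand side through the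
      variable condition, so this peak is trivial.\<close>
    have "subst l1 \<sigma>1 = subst l1 (\<lambda>x. \<sigma>2 (\<pi> x))"
      using variant(4) by (simp add: \<pi>(1) subst_subst)
    moreover have "vars r1 \<subseteq> vars l1" using variant(1) R_gt by (intro rule_vars_subset) auto
    ultimately have "subst r1 \<sigma>1 = subst r1 (\<lambda>x. \<sigma>2 (\<pi> x))"
      by (intro subst_cong) (auto dest: subst_eqD)
    then have "s = t" using variant(5,6) by (simp add: \<pi>(2) subst_subst)
    then show ?thesis by simp
  next
    case (variable l r x q' \<sigma> \<sigma>')
    let ?C = "replace_at u p"
    \<comment> \<open>Both sides meet in the instance of \<open>r\<close> under
      \<open>\<sigma>'\<close>: \<open>s\<close> first completes the remaining occurrences of
      \<open>x\<close> in \<open>l\<close>, and \<open>t\<close> rewrites all copies of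
      \<open>x\<close> in \<open>r\<close>.\<close>
    note \<sigma> = update_rsteps[of \<sigma> x \<sigma>', OF variable(8,9)]
    have "(?C (replace_at (subst l \<sigma>) q' (\<sigma>' x)), ?C (subst l \<sigma>')) \<in> (rstep R)\<^sup>*"
      using replace_var_rsteps[OF variable(6,7) \<sigma>] variable(2)
      by (rule rewrite_closed_ctxt[OF rewrite_closed_rtrancl[OF rewrite_closed_rstep]])
    moreover have "(?C (subst l \<sigma>'), ?C (subst r \<sigma>')) \<in> rstep R"
      using variable(1,2) by (rule rstepI)
    ultimately have "(s, ?C (subst r \<sigma>')) \<in> (rstep R)\<^sup>*" unfolding variable(5) by simp
    moreover have "(t, ?C (subst r \<sigma>')) \<in> (rstep R)\<^sup>*"
      unfolding variable(4) using subst_rsteps[OF \<sigma>] variable(2)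
      by (rule rewrite_closed_ctxt[OF rewrite_closed_rtrancl[OF rewrite_closed_rstep]])
    ultimately show ?thesis
      using rsteps_below rstep_gt us ut conv_below_sym below_trans by metis
  qed
qed

lemma prime_cliff_R_in_B:
  assumes inner: "(u, s) \<in> rstep_at R (p @ q)" and outer: "(u, t) \<in> rstep_at (Bpm B) p"
    and prime: "prime_at R (subt_at u (p @ q))"
  shows "\<exists>s'. (t, s') \<in> rstep R \<and> (s', s) \<in> conv_below u"
proof -
  have us: "(u, s) \<in> rstep R" and ut: "(u, t) \<in> sstep B"
    using inner Bpm_step[OF outer] rstep_iff_rstep_at by blast+
  from inf inner outer prime show ?thesis
  proof (cases rule: nested_rstep_at_cases)
    case critical
    then show ?thesis using critical_cliff us ut by (simp add: PCP_pm_def rstep_Un sstep_def)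
  next
    case (variant l1 r1 l2 r2 \<sigma>1 \<sigma>2)
    then show ?thesis using not_variant_R_B by blast
  next
    case (variable l r x q' \<sigma> \<sigma>')
    let ?C = "replace_at u p"
    note \<sigma> = update_rsteps[of \<sigma> x \<sigma>', OF variable(8,9)]
    note ctxt = rewrite_closed_ctxt[OF rewrite_closed_rtrancl[OF rewrite_closed_rstep] _ variable(2)]
    \<comment> \<open>\<open>s\<close> completes all occurrences of \<open>x\<close> in
      \<open>l\<close>, after which one \<open>B\<close>-step leads to the completed instance of
      \<open>r\<close>.\<close>
    have s: "(s, ?C (subst l \<sigma>')) \<in> (rstep R)\<^sup>*"
      unfolding variable(5) using replace_var_rsteps[OF variable(6,7) \<sigma>] by (rule ctxt)
    have B: "(?C (subst l \<sigma>'), ?C (subst r \<sigma>')) \<in> simB B"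
      using rstepI[OF variable(1,2)] unfolding rstep_Bpm by (rule sstep_simB)
    \<comment> \<open>Since \<open>B\<close> preserves variables, \<open>x\<close> survives in
      \<open>r\<close>; rewriting one of its occurrences gives the required step out of
      \<open>t\<close>.\<close>
    have "x \<in> vars r"
      using vars_subt_at[OF variable(6)] variable(7) Bpm_vars[OF variable(1)] by auto
    then obtain q'' where q'': "q'' \<in> poss r" "subt_at r q'' = Var x" by (rule vars_obtain_pos)
    have q''r: "q'' \<in> poss (subst r \<sigma>)" using q''(1) by (rule poss_subst)
    define s' where "s' = ?C (replace_at (subst r \<sigma>) q'' (\<sigma>' x))"
    have "replace_at (subst r \<sigma>) q'' (\<sigma> x) = subst r \<sigma>"
      using replace_at_subt_at[OF q''r] q'' by (simp add: subt_at_subst)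
    then have ts': "(t, s') \<in> rstep R"
      using rewrite_closed_ctxt[OF rewrite_closed_rstep
          rewrite_closed_ctxt[OF rewrite_closed_rstep variable(8) q''r] variable(2)]
      unfolding s'_def variable(4) by simp
    have s': "(s', ?C (subst r \<sigma>')) \<in> (rstep R)\<^sup>*"
      unfolding s'_def using replace_var_rsteps[OF q'' \<sigma>] by (rule ctxt)
    have gs: "(u, s) \<in> gt" using us by (rule rstep_gt)
    have gs': "(u, s') \<in> gt" using sstep_simB[OF ut] rstep_gt[OF ts'] by (rule simB_gt)
    have "(s, ?C (subst r \<sigma>')) \<in> conv_below u"
      using rsteps_below[OF s gs] simB_below[OF B rsteps_gt[OF s gs]] by (rule below_trans)
    then have "(s', s) \<in> conv_below u"
      using rsteps_below[OF s' gs'] conv_below_sym below_trans by metis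
    then show ?thesis using ts' by blast
  qed
qed

lemma prime_cliff_B_in_R:
  assumes inner: "(u, t) \<in> rstep_at (Bpm B) (p @ q)" and outer: "(u, s) \<in> rstep_at R p"
    and prime: "prime_at R (subt_at u (p @ q))"
  shows "\<exists>s'. (t, s') \<in> rstep R \<and> (s', s) \<in> conv_below u"
proof -
  have us: "(u, s) \<in> rstep R" and ut: "(u, t) \<in> sstep B"
    using outer Bpm_step[OF inner] rstep_iff_rstep_at by blast+
  from inf inner outer prime show ?thesis
  proof (cases rule: nested_rstep_at_cases)
    case critical
    then show ?thesis using critical_cliff us ut by (simp add: PCP_pm_def rstep_Un sstep_def)
  next
    case (variant l1 r1 l2 r2 \<sigma>1 \<sigma>2)
    then show ?thesis using not_variant_R_B by blast
  next
    case (variable l r x q' \<sigma> \<sigma>')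
    let ?C = "replace_at u p"
    note \<sigma> = update_rsteps[of \<sigma> x \<sigma>', OF variable(8,9)]
    \<comment> \<open>The \<open>B\<close>-step changed the only occurrence of \<open>x\<close> in
      \<open>l\<close>, so \<open>t\<close> is still an instance of \<open>l\<close> and the rule
      applies to it.\<close>
    have "linear l" using ll variable(1) by (auto simp: left_linear_def)
    then have t: "t = ?C (subst l \<sigma>')"
      using linear_replace_var[of q' l x \<sigma>' \<sigma>, OF variable(6) _ variable(7,9)] variable(5) by simp
    have step: "(t, ?C (subst r \<sigma>')) \<in> rstep R"
      unfolding t using variable(1,2) by (rule rstepI)
    have "(s, ?C (subst r \<sigma>')) \<in> (rstep (Bpm B))\<^sup>*"
      unfolding variable(4) using subst_rsteps[OF \<sigma>] variable(2)
      by (rule rewrite_closed_ctxt[OF rewrite_closed_rtrancl[OF rewrite_closed_rstep]])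
    then have "(s, ?C (subst r \<sigma>')) \<in> simB B" by (simp add: rstep_Bpm simB_def conv_def)
    then have "(s, ?C (subst r \<sigma>')) \<in> conv_below u" using rstep_gt[OF us] by (rule simB_below)
    then show ?thesis using step conv_below_sym by blast
  qed
qed

section \<open>Reduction to prime peaks and cliffs\<close>

lemma innermost_below:
  assumes "p \<in> poss u" "\<not> prime_at R (subt_at u p)"
  obtains q v where "(u, v) \<in> rstep_at R (p @ q)" "prime_at R (subt_at u (p @ q))"
proof -
  obtain q s where q: "(subt_at u p, s) \<in> rstep_at R q" "prime_at R (subt_at (subt_at u p) q)"
    using not_prime_at_innermost[OF assms(2)] by metis
  from q(1) obtain l r \<sigma> where "(l, r) \<in> R" "q \<in> poss (subt_at u p)" "subt_at (subt_at u p) q = subst l \<sigma>"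
    by (rule rstep_atE)
  then have "(u, replace_at u (p @ q) (subst r \<sigma>)) \<in> rstep_at R (p @ q)"
    unfolding rstep_at_def using assms(1) by (auto simp: poss_append subt_at_append)
  then show thesis using that q(2) assms(1) by (simp add: subt_at_append)
qed

lemma nested_peak:
  assumes inner: "(u, s) \<in> rstep_at R (p @ q)" and outer: "(u, t) \<in> rstep_at R p"
  shows "(s, t) \<in> conv_below u"
proof (cases "prime_at R (subt_at u (p @ q))")
  case True
  then show ?thesis using prime_peak inner outer by blast
next
  case False
  have "p @ q \<in> poss u" using inner by (rule rstep_atE)
  then obtain q' v where v: "(u, v) \<in> rstep_at R ((p @ q) @ q')" "prime_at R (subt_at u ((p @ q) @ q'))"
    using innermost_below False by blast
  \<comment> \<open>The innermost redex lies below both positions, so \<open>v\<close> forms a prime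
    peak with \<open>s\<close> and another one with \<open>t\<close>.\<close>
  have "(v, s) \<in> conv_below u" using prime_peak[OF v(1) inner v(2)] .
  moreover have "(v, t) \<in> conv_below u" using prime_peak[of u v p "q @ q'" t] v outer by simp
  ultimately show ?thesis using conv_below_sym below_trans by metis
qed

lemma peak:
  assumes "(u, s) \<in> rstep R" "(u, t) \<in> rstep R"
  shows "(s, t) \<in> conv_below u"
proof -
  obtain p q where s: "(u, s) \<in> rstep_at R p" and t: "(u, t) \<in> rstep_at R q"
    using assms rstep_iff_rstep_at by blast
  show ?thesis
  proof (cases rule: position_cases[where p = q and q = p])
    case (below r)
    then show ?thesis using nested_peak t s conv_below_sym by blast
  next
    case (above r)
    then show ?thesis using nested_peak t s conv_below_sym by blast
  next
    case parallel
    then obtain w where "(s, w) \<in> rstep R" "(t, w) \<in> rstep R"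
      using parallel_rstep_at[OF s t] parallel_pos_sym by blast
    then show ?thesis using rstep_below rstep_gt assms conv_below_sym below_trans by metis
  qed
qed

lemma nested_cliff_R_in_B:
  assumes inner: "(u, s) \<in> rstep_at R (p @ q)" and outer: "(u, t) \<in> rstep_at (Bpm B) p"
  shows "\<exists>s'. (t, s') \<in> rstep R \<and> (s', s) \<in> conv_below u"
proof (cases "prime_at R (subt_at u (p @ q))")
  case True
  then show ?thesis using prime_cliff_R_in_B inner outer by blast
next
  case False
  have "p @ q \<in> poss u" using inner by (rule rstep_atE)
  then obtain q' v where v: "(u, v) \<in> rstep_at R ((p @ q) @ q')" "prime_at R (subt_at u ((p @ q) @ q'))"
    using innermost_below False by blast
  \<comment> \<open>A prime peak exchanges \<open>s\<close> for \<open>v\<close>, and the prime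
    cliff with \<open>v\<close> supplies the step out of \<open>t\<close>.\<close>
  have "(v, s) \<in> conv_below u" using prime_peak[OF v(1) inner v(2)] .
  moreover have "\<exists>s'. (t, s') \<in> rstep R \<and> (s', v) \<in> conv_below u"
    using prime_cliff_R_in_B[of u v p "q @ q'" t] v outer by simp
  ultimately show ?thesis using below_trans by metis
qed

lemma nested_cliff_B_in_R:
  assumes inner: "(u, t) \<in> rstep_at (Bpm B) (p @ q)" and outer: "(u, s) \<in> rstep_at R p"
  shows "\<exists>s'. (t, s') \<in> rstep R \<and> (s', s) \<in> conv_below u"
proof (cases "prime_at R (subt_at u (p @ q))")
  case True
  then show ?thesis using prime_cliff_B_in_R inner outer by blast
next
  case False
  have "p @ q \<in> poss u" using inner by (rule rstep_atE)
  then obtain q' v where v: "(u, v) \<in> rstep_at R ((p @ q) @ q')" "prime_at R (subt_at u ((p @ q) @ q'))"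
    using innermost_below False by blast
  \<comment> \<open>The innermost \<open>R\<close>-redex lies inside the \<open>B\<close>-redex, so
    the cliff with \<open>v\<close> has the opposite nesting: \<open>R\<close> within
    \<open>B\<close>.\<close>
  have "(v, s) \<in> conv_below u" using prime_peak[of u v p "q @ q'" s] v outer by simp
  moreover have "\<exists>s'. (t, s') \<in> rstep R \<and> (s', v) \<in> conv_below u"
    using prime_cliff_R_in_B[OF v(1) inner v(2)] .
  ultimately show ?thesis using below_trans by metis
qed

lemma cliff:
  assumes "(u, s) \<in> rstep R" "(u, t) \<in> sstep B"
  shows "\<exists>s'. (t, s') \<in> rstep R \<and> (s', s) \<in> conv_below u"
proof -
  obtain p q where s: "(u, s) \<in> rstep_at R p" and t: "(u, t) \<in> rstep_at (Bpm B) q"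
    using assms unfolding rstep_Bpm[symmetric] rstep_iff_rstep_at by blast
  show ?thesis
  proof (cases rule: position_cases[where p = q and q = p])
    case (below r)
    then show ?thesis using nested_cliff_R_in_B t s by blast
  next
    case (above r)
    then show ?thesis using nested_cliff_B_in_R t s by blast
  next
    case parallel
    then obtain w where w: "(s, w) \<in> rstep (Bpm B)" "(t, w) \<in> rstep R"
      using parallel_rstep_at[OF s t] parallel_pos_sym by blast
    then have "(s, w) \<in> simB B" unfolding rstep_Bpm by (intro sstep_simB)
    then have "(s, w) \<in> conv_below u" using rstep_gt[OF assms(1)] by (rule simB_below)
    then show ?thesis using w(2) conv_below_sym by blast
  qed
qed

lemma Church_Rosser: "CR_mod R B"
proof -
  have eq: "rstep R \<union> (rstep R)\<inverse> \<union> sstep B = sstep (R \<union> B)"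
    by (simp add: sstep_Un sstep_def[of R])
  have "(rstep R \<union> (rstep R)\<inverse> \<union> sstep B)\<^sup>* \<subseteq> (rstep R)\<^sup>* O (sstep B)\<^sup>* O ((rstep R)\<inverse>)\<^sup>*"
  proof (rule peaks_cliffs_imp_Church_Rosser[OF wf_gt])
    show "trans gt" using gt_trans by (rule transI)
    show "rstep R \<subseteq> gt" using rstep_gt by auto
    show "sym (sstep B)" by (rule sym_sstep)
    show "(sstep B)\<^sup>* O gt O (sstep B)\<^sup>* \<subseteq> gt"
      using gt_simB simB_gt unfolding simB_def conv_def by blast
  qed (use peak cliff in \<open>simp_all add: eq\<close>)
  then show ?thesis
    unfolding eq CR_mod_def join_mod_def simB_def conv_def .
qed

end

section \<open>Runs\<close>

text \<open>Besides orientation, \<open>deduce_cliff\<close> adds a rule whose left side is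
  \<open>B\<close>-equivalent to a term that rewrites to its right side, and \<open>compose\<close>
  lowers a right side; compatibility and transitivity keep both decreasing.\<close>

lemma IA_step_gt:
  assumes "IA_step B gt S S'" "B_compatible_reduction_order B gt" "snd S \<subseteq> gt"
  shows "snd S' \<subseteq> gt"
  using assms(1)
proof cases
  case (deduce_cliff s t R E)
  interpret compatible_trs R B gt using assms deduce_cliff by unfold_locales auto
  show ?thesis
    using deduce_cliff R_gt by (auto intro: simB_gt rstep_gt sstep_simB symD[OF sym_sstep])
next
  case (compose s t R u E)
  interpret compatible_trs "R - {(s, t)}" B gt using assms compose by unfold_locales auto
  have "(s, t) \<in> gt" using assms(3) compose by auto
  then show ?thesis
    using compose R_gt by (auto intro: gt_trans rel_mod_gt)
qed (use assms in auto)

section \<open>Invariance of the equational theory\<close>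

lemma rstep_conv: "R \<subseteq> S \<Longrightarrow> (s, t) \<in> rstep R \<Longrightarrow> (s, t) \<in> conv S"
  using rstep_mono[of R S] by (auto simp: conv_def sstep_def)

lemma sstep_conv: "R \<subseteq> S \<Longrightarrow> (s, t) \<in> sstep R \<Longrightarrow> (s, t) \<in> conv S"
  using rstep_mono[of R S] by (auto simp: conv_def sstep_def)

lemma conv_sym: "(s, t) \<in> conv S \<Longrightarrow> (t, s) \<in> conv S"
  using sym_conv by (rule symD)

lemma conv_trans: "(s, t) \<in> conv S \<Longrightarrow> (t, u) \<in> conv S \<Longrightarrow> (s, u) \<in> conv S"
  by (simp add: conv_def)

lemma simB_conv:
  assumes "B \<subseteq> S" "(s, t) \<in> simB B"
  shows "(s, t) \<in> conv S"
proof -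
  have "sstep B \<subseteq> sstep S" using rstep_mono[OF assms(1)] by (auto simp: sstep_def)
  from rtrancl_mono[OF this] show ?thesis using assms(2) by (auto simp: simB_def conv_def)
qed

lemma rel_mod_conv:
  assumes "R \<union> B \<subseteq> S" "(s, t) \<in> rel_mod R B"
  shows "(s, t) \<in> conv S"
proof -
  obtain a b where "(s, a) \<in> simB B" "(a, b) \<in> rstep R" "(b, t) \<in> simB B"
    using assms(2) unfolding rel_mod_def by blast
  then show ?thesis
    using simB_conv[of B S s a] rstep_conv[of R S a b] simB_conv[of B S b t] assms(1)
      conv_trans[of s a S b] conv_trans[of s b S t] by simp
qed

lemma in_conv: "e \<in> S \<Longrightarrow> e \<in> conv S"
  using rstep_rule[of S] rstep_conv[of S S] by (cases e) auto

lemma conv_insert_swap: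
  assumes "e = (s, t) \<or> e = (t, s)"
  shows "e \<in> conv (insert (s, t) C) \<and> (s, t) \<in> conv (insert e C)"
  using assms
proof
  assume e: "e = (s, t)"
  show ?thesis unfolding e by (intro conjI in_conv insertI1)
next
  assume e: "e = (t, s)"
  show ?thesis unfolding e by (intro conjI conv_sym[OF in_conv] insertI1)
qed

text \<open>An inference exchanges at most one pair over a common part \<open>C\<close>; where
  nothing is lost or gained, a reflexive pair takes its place.\<close>

lemma conv_step_eqI:
  assumes "S \<subseteq> insert e C" "T \<subseteq> insert e' C" "C \<subseteq> S" "C \<subseteq> T" "e \<in> conv T" "e' \<in> conv S"
  shows "conv S = conv T"
proof (intro equalityI conv_least)
  have "C \<subseteq> conv S" "C \<subseteq> conv T" using assms(3,4) in_conv by blast+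
  then show "S \<subseteq> conv T" "T \<subseteq> conv S" using assms by blast+
qed

lemma conv_exchange:
  "e \<in> conv (insert e' C) \<Longrightarrow> e' \<in> conv (insert e C) \<Longrightarrow> conv (insert e C) = conv (insert e' C)"
  by (rule conv_step_eqI[of _ e C _ e']) auto

lemma IA_step_conv:
  assumes "IA_step B gt S S'"
  shows "conv (fst S \<union> snd S \<union> B) = conv (fst S' \<union> snd S' \<union> B)"
  using assms
proof cases
  case (deduce_peak s t R E)
  obtain v where v: "(v, s) \<in> rstep R" "(v, t) \<in> rstep R" using deduce_peak(3) by blast
  have "(s, v) \<in> conv (E \<union> R \<union> B)" "(v, t) \<in> conv (E \<union> R \<union> B)"
    by (rule conv_sym[OF rstep_conv[OF _ v(1)]] rstep_conv[OF _ v(2)], blast)+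
  then have "(s, t) \<in> conv (E \<union> R \<union> B)" by (rule conv_trans)
  then show ?thesis
    using deduce_peak by (intro conv_step_eqI[where e = "(s, s)" and e' = "(s, t)" and C = "E \<union> R \<union> B"])
      (auto simp: conv_def)
next
  case (deduce_cliff s t R E)
  obtain v where v: "(v, s) \<in> rstep R" "(v, t) \<in> sstep B" using deduce_cliff(3) by blast
  have "(t, v) \<in> conv (E \<union> R \<union> B)" "(v, s) \<in> conv (E \<union> R \<union> B)"
    by (rule conv_sym[OF sstep_conv[OF _ v(2)]] rstep_conv[OF _ v(1)], blast)+
  then have "(t, s) \<in> conv (E \<union> R \<union> B)" by (rule conv_trans)
  then show ?thesis
    using deduce_cliff by (intro conv_step_eqI[where e = "(s, s)" and e' = "(t, s)" and C = "E \<union> R \<union> B"])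
      (auto simp: conv_def)
next
  case (orient e E s t R)
  let ?C = "(E - {e}) \<union> R \<union> B"
  have 1: "e \<in> conv (insert (s, t) ?C)" and 2: "(s, t) \<in> conv (insert e ?C)"
    using conv_insert_swap[OF orient(4)] by blast+
  have eq: "fst S \<union> snd S \<union> B = insert e ?C" "fst S' \<union> snd S' \<union> B = insert (s, t) ?C"
    using orient by auto
  show ?thesis unfolding eq by (rule conv_exchange[OF 1 2])
next
  case (delete s t E R)
  let ?C = "(E - {(s, t)}) \<union> R \<union> B"
  have "(s, t) \<in> conv ?C" using delete(4) by (intro simB_conv[of B]) auto
  moreover have "fst S \<union> snd S \<union> B = insert (s, t) ?C" "fst S' \<union> snd S' \<union> B = ?C"
    using delete by auto
  ultimately show ?thesis
    by (intro conv_step_eqI[where e = "(s, t)" and e' = "(s, s)" and C = ?C]) (auto simp: conv_def)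
next
  case (simplify e E s t u R)
  let ?C = "(E - {e}) \<union> R \<union> B"
  have su: "(s, u) \<in> conv T" if "?C \<subseteq> T" for T
    using simplify(5) that by (intro rel_mod_conv[of R B]) auto
  have "(s, t) \<in> conv (insert (u, t) ?C)"
    by (rule conv_trans[OF su[OF subset_insertI] in_conv[OF insertI1]])
  then have 1: "e \<in> conv (insert (u, t) ?C)" using simplify(4) conv_sym[of s t] by blast
  have "(s, t) \<in> conv (insert e ?C)"
    using conv_insert_swap[OF simplify(4)] by blast
  then have 2: "(u, t) \<in> conv (insert e ?C)"
    by (rule conv_trans[OF conv_sym[OF su[OF subset_insertI]]])
  have eq: "fst S \<union> snd S \<union> B = insert e ?C" "fst S' \<union> snd S' \<union> B = insert (u, t) ?C"
    using simplify by auto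
  show ?thesis unfolding eq by (rule conv_exchange[OF 1 2])
next
  case (collapse s t R u E)
  let ?C = "E \<union> (R - {(s, t)}) \<union> B"
  \<comment> \<open>The collapsing rule differs from the collapsed one, so it is available before
    and after the inference.\<close>
  have su: "(s, u) \<in> conv T" if "?C \<subseteq> T" for T
    using collapse(4) that by (intro rstep_conv[of "R - {(s, t)}"]) auto
  have 1: "(s, t) \<in> conv (insert (u, t) ?C)"
    by (rule conv_trans[OF su[OF subset_insertI] in_conv[OF insertI1]])
  have 2: "(u, t) \<in> conv (insert (s, t) ?C)"
    by (rule conv_trans[OF conv_sym[OF su[OF subset_insertI]] in_conv[OF insertI1]])
  have eq: "fst S \<union> snd S \<union> B = insert (s, t) ?C" "fst S' \<union> snd S' \<union> B = insert (u, t) ?C"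
    using collapse by auto
  show ?thesis unfolding eq by (rule conv_exchange[OF 1 2])
next
  case (compose s t R u E)
  let ?C = "E \<union> (R - {(s, t)}) \<union> B"
  have tu: "(t, u) \<in> conv T" if "?C \<subseteq> T" for T
    using compose(4) that by (intro rel_mod_conv[of "R - {(s, t)}" B]) auto
  have 1: "(s, t) \<in> conv (insert (s, u) ?C)"
    by (rule conv_trans[OF in_conv[OF insertI1] conv_sym[OF tu[OF subset_insertI]]])
  have 2: "(s, u) \<in> conv (insert (s, t) ?C)"
    by (rule conv_trans[OF in_conv[OF insertI1] tu[OF subset_insertI]])
  have eq: "fst S \<union> snd S \<union> B = insert (s, t) ?C" "fst S' \<union> snd S' \<union> B = insert (s, u) ?C"
    using compose by auto
  show ?thesis unfolding eq by (rule conv_exchange[OF 1 2])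
qed

section \<open>Intermediate steps as conversions of the final system\<close>

lemma rstep_insert_cases:
  assumes "(a, b) \<in> rstep S" "S \<subseteq> insert e T"
  obtains "(a, b) \<in> rstep T" | "(a, b) \<in> rstep {e}"
  using rstep_mono[OF assms(2)] assms(1) rstep_Un[of "{e}" T] by auto

lemma rstep_singletonE:
  assumes "(a, b) \<in> rstep {(s, t)}"
  obtains p u \<sigma> where "p \<in> poss u" "a = replace_at u p (subst s \<sigma>)" "b = replace_at u p (subst t \<sigma>)"
  using assms by (rule rstepE) auto

lemma sym_join_mod: "(s, t) \<in> join_mod R B \<Longrightarrow> (t, s) \<in> join_mod R B"
  unfolding join_mod_def rtrancl_converse using simB_sym by blast

context compatible_trs
begin

text \<open>Equations have no orientation, so the bound is an arbitrary term above both
  ends.\<close>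

definition connects_eqs :: "('f, 'v) rule set \<Rightarrow> bool" where
  "connects_eqs E' \<longleftrightarrow> (\<forall>s t w. (s, t) \<in> rstep E' \<longrightarrow> (w, s) \<in> gt \<longrightarrow> (w, t) \<in> gt \<longrightarrow> (s, t) \<in> conv_below w)"

text \<open>Rules must provide more: a final step out of the same source, with the rest bounded by
  that source. Cliffs depend on this step, matching a fairness condition that admits only rules
  there.\<close>

definition connects_rules :: "('f, 'v) rule set \<Rightarrow> bool" where
  "connects_rules R' \<longleftrightarrow> (\<forall>s t. (s, t) \<in> rstep R' \<longrightarrow> (\<exists>s'. (s, s') \<in> rstep R \<and> (s', t) \<in> conv_below s))"

lemma connects_rules_self: "connects_rules R"
  unfolding connects_rules_def using below_refl by metis

lemma connects_rules_mono: "connects_rules S \<Longrightarrow> R' \<subseteq> S \<Longrightarrow> connects_rules R'"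
  unfolding connects_rules_def using rstep_mono by blast

lemma connects_rules_below:
  assumes "connects_rules R'" "(s, t) \<in> rstep R'" "(w, s) \<in> gt"
  shows "(s, t) \<in> conv_below w"
proof -
  obtain s' where s': "(s, s') \<in> rstep R" "(s', t) \<in> conv_below s"
    using assms(1,2) unfolding connects_rules_def by blast
  show ?thesis
    using rstep_below[OF s'(1) assms(3)] conv_below_gt[OF assms(3) s'(2)] by (rule below_trans)
qed

lemma connects_rules_rel_mod:
  assumes "connects_rules R'" "R' \<subseteq> gt" "(s, t) \<in> rel_mod R' B" "(w, s) \<in> gt"
  shows "(s, t) \<in> conv_below w"
proof -
  obtain a b where ab: "(s, a) \<in> simB B" "(a, b) \<in> rstep R'" "(b, t) \<in> simB B"
    using assms(3) unfolding rel_mod_def by blast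
  have a: "(w, a) \<in> gt" using assms(4) ab(1) by (rule gt_simB)
  have "(a, b) \<in> gt" using rstep_least[OF rewrite_closed_gt assms(2)] ab(2) by blast
  then have b: "(w, b) \<in> gt" using a gt_trans by blast
  show ?thesis
    using simB_below[OF ab(1) assms(4)] connects_rules_below[OF assms(1) ab(2) a] simB_below[OF ab(3) b]
      below_trans by metis
qed

lemma connects_eqs_insert:
  assumes "connects_eqs E1" "E0 \<subseteq> insert e E1"
    and "\<And>a b w. (a, b) \<in> rstep {e} \<Longrightarrow> (w, a) \<in> gt \<Longrightarrow> (w, b) \<in> gt \<Longrightarrow> (a, b) \<in> conv_below w"
  shows "connects_eqs E0"
  unfolding connects_eqs_def using assms rstep_insert_cases[OF _ assms(2)] unfolding connects_eqs_def by metis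

lemma connects_rules_insert:
  assumes "connects_rules R1" "R0 \<subseteq> insert e R1"
    and "\<And>a b. (a, b) \<in> rstep {e} \<Longrightarrow> \<exists>a'. (a, a') \<in> rstep R \<and> (a', b) \<in> conv_below a"
  shows "connects_rules R0"
  unfolding connects_rules_def using assms rstep_insert_cases[OF _ assms(2)] unfolding connects_rules_def by metis

lemma connects_eqs_mono: "connects_eqs S \<Longrightarrow> E' \<subseteq> S \<Longrightarrow> connects_eqs E'"
  unfolding connects_eqs_def using rstep_mono by blast

text \<open>Read backwards, the pair removed by an inference is recovered from the pairs present
  afterwards, along a detour that never exceeds the bound.\<close>

lemma IA_step_connects:
  assumes step: "IA_step B gt S S'" and S: "snd S \<subseteq> gt"
    and conn: "connects_eqs (fst S')" "connects_rules (snd S')"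
  shows "connects_eqs (fst S) \<and> connects_rules (snd S)"
  using step
proof cases
  case (deduce_peak s t R E)
  then show ?thesis using conn by (auto intro: connects_eqs_mono)
next
  case (deduce_cliff s t R E)
  then show ?thesis using conn by (auto intro: connects_rules_mono)
next
  case (orient e E s t R')
  have "connects_eqs E"
  proof (rule connects_eqs_insert[of "E - {e}" _ e])
    show "connects_eqs (E - {e})" using conn orient by simp
    fix a b w
    assume ab: "(a, b) \<in> rstep {e}" and w: "(w, a) \<in> gt" "(w, b) \<in> gt"
    \<comment> \<open>Orientation has placed \<open>e\<close> or its reverse among the later
      rules.\<close>
    have e: "{e} \<subseteq> R' \<union> {(s, t)} \<or> {e} \<subseteq> (R' \<union> {(s, t)})\<inverse>" using orient(4) by auto
    have "(a, b) \<in> rstep (R' \<union> {(s, t)}) \<or> (b, a) \<in> rstep (R' \<union> {(s, t)})"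
      using e rstep_mono[of "{e}"] ab rstep_converse[of "R' \<union> {(s, t)}"] by blast
    then show "(a, b) \<in> conv_below w"
      using conn(2) orient(2) w connects_rules_below conv_below_sym by auto
  qed auto
  then show ?thesis using conn orient by (auto intro: connects_rules_mono)
next
  case (delete s t E R')
  have "connects_eqs E"
  proof (rule connects_eqs_insert[of "E - {(s, t)}" _ "(s, t)"])
    show "connects_eqs (E - {(s, t)})" using conn delete by simp
    fix a b w
    assume ab: "(a, b) \<in> rstep {(s, t)}" and w: "(w, a) \<in> gt"
    have "(a, b) \<in> simB B" using rstep_least[OF rewrite_closed_simB, of "{(s, t)}" B] delete(4) ab by auto
    then show "(a, b) \<in> conv_below w" using w by (rule simB_below)
  qed auto
  then show ?thesis using conn delete by simp
next
  case (simplify e E s t u R')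
  have main: "(a, b) \<in> conv_below w"
    if ab: "(a, b) \<in> rstep {(s, t)}" and w: "(w, a) \<in> gt" "(w, b) \<in> gt" for a b w
  proof -
    obtain p v \<sigma> where p: "p \<in> poss v" and a: "a = replace_at v p (subst s \<sigma>)"
      and b: "b = replace_at v p (subst t \<sigma>)" using ab by (rule rstep_singletonE)
    define c where "c = replace_at v p (subst u \<sigma>)"
    have ac: "(a, c) \<in> rel_mod R' B"
      unfolding a c_def using rewrite_closed_rel_mod simplify(5) p by (rule rewrite_closedD)
    have cb: "(c, b) \<in> rstep (fst S')" unfolding b c_def by (rule rstepI) (use simplify p in auto)
    interpret R': compatible_trs R' B gt using order S simplify by unfold_locales auto
    \<comment> \<open>Simplification decreases, so \<open>c\<close> is again below \<open>w\<close>
      and the new equation may be used with the same bound.\<close>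
    have "(w, c) \<in> gt" using w(1) R'.rel_mod_gt[OF ac] by (rule gt_trans)
    then have "(c, b) \<in> conv_below w" using conn(1) cb w(2) unfolding connects_eqs_def by blast
    moreover have "(a, c) \<in> conv_below w"
      using conn(2) simplify R'.R_gt ac w(1) by (intro connects_rules_rel_mod[of R']) auto
    ultimately show ?thesis using below_trans by metis
  qed
  have "connects_eqs E"
  proof (rule connects_eqs_insert[of "E - {e}" _ e])
    show "connects_eqs (E - {e})" using conn(1) simplify by (auto intro: connects_eqs_mono)
    fix a b w
    assume ab: "(a, b) \<in> rstep {e}" and w: "(w, a) \<in> gt" "(w, b) \<in> gt"
    have "(a, b) \<in> rstep {(s, t)} \<or> (b, a) \<in> rstep {(s, t)}"
    proof -
      have "{(t, s)} = {(s, t)}\<inverse>" by auto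
      then have "rstep {(t, s)} = (rstep {(s, t)})\<inverse>" by (simp only: rstep_converse)
      then show ?thesis using simplify(4) ab by auto
    qed
    then show "(a, b) \<in> conv_below w" using main w conv_below_sym by blast
  qed auto
  then show ?thesis using conn simplify by simp
next
  case (collapse s t R' u E)
  let ?R = "R' - {(s, t)}"
  have S': "fst S' = E \<union> {(u, t)}" "snd S' = ?R" using collapse by auto
  have R'gt: "R' \<subseteq> gt" using S collapse by simp
  have "connects_rules R'"
  proof (rule connects_rules_insert[of ?R _ "(s, t)"])
    show "connects_rules ?R" using conn S' by simp
    fix a b
    assume ab: "(a, b) \<in> rstep {(s, t)}"
    then obtain p v \<sigma> where p: "p \<in> poss v" and a: "a = replace_at v p (subst s \<sigma>)"
      and b: "b = replace_at v p (subst t \<sigma>)" by (rule rstep_singletonE)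
    define c where "c = replace_at v p (subst u \<sigma>)"
    have ac: "(a, c) \<in> rstep ?R"
      unfolding a c_def using rewrite_closed_rstep collapse(4) p by (rule rewrite_closedD)
    have cb: "(c, b) \<in> rstep (fst S')" unfolding b c_def by (rule rstepI) (use S' p in auto)
    \<comment> \<open>Both \<open>b\<close> and \<open>c\<close> are reducts of \<open>a\<close>, so
      the equation left by the collapse may be used with bound \<open>a\<close>; the final step out
      of \<open>a\<close> comes from the collapsing rule.\<close>
    have "(a, c) \<in> gt" using rstep_least[OF rewrite_closed_gt, of ?R] R'gt ac by blast
    moreover have "(a, b) \<in> gt" using rstep_least[OF rewrite_closed_gt, of "{(s, t)}"] R'gt collapse(3) ab by blast
    ultimately have "(c, b) \<in> conv_below a" using conn(1) cb unfolding connects_eqs_def by blast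
    moreover obtain a' where "(a, a') \<in> rstep R" "(a', c) \<in> conv_below a"
      using conn(2) ac unfolding S' connects_rules_def by blast
    ultimately show "\<exists>a'. (a, a') \<in> rstep R \<and> (a', b) \<in> conv_below a" using below_trans by metis
  qed auto
  then show ?thesis using conn S' collapse by (auto intro: connects_eqs_mono)
next
  case (compose s t R' u E)
  let ?R = "R' - {(s, t)}"
  have S': "fst S' = E" "snd S' = ?R \<union> {(s, u)}" using compose by auto
  have R'gt: "R' \<subseteq> gt" using S compose by simp
  have conn_R: "connects_rules ?R" using conn S' by (auto intro: connects_rules_mono)
  have "connects_rules R'"
  proof (rule connects_rules_insert[of ?R _ "(s, t)", OF conn_R])
    fix a b
    assume ab: "(a, b) \<in> rstep {(s, t)}"
    then obtain p v \<sigma> where p: "p \<in> poss v" and a: "a = replace_at v p (subst s \<sigma>)"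
      and b: "b = replace_at v p (subst t \<sigma>)" by (rule rstep_singletonE)
    define c where "c = replace_at v p (subst u \<sigma>)"
    have ac: "(a, c) \<in> rstep (snd S')" unfolding a c_def by (rule rstepI) (use S' p in auto)
    have bc: "(b, c) \<in> rel_mod ?R B"
      unfolding b c_def using rewrite_closed_rel_mod compose(4) p by (rule rewrite_closedD)
    \<comment> \<open>The detour from \<open>b\<close> to \<open>c\<close> starts below
      \<open>a\<close>, while the final step out of \<open>a\<close> comes from the composed
      rule.\<close>
    have "(a, b) \<in> gt" using rstep_least[OF rewrite_closed_gt, of "{(s, t)}"] R'gt compose(3) ab by blast
    then have "(b, c) \<in> conv_below a" using conn_R R'gt bc by (intro connects_rules_rel_mod[of ?R]) auto
    moreover obtain a' where "(a, a') \<in> rstep R" "(a', c) \<in> conv_below a"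
      using conn(2) ac unfolding connects_rules_def by blast
    ultimately show "\<exists>a'. (a, a') \<in> rstep R \<and> (a', b) \<in> conv_below a"
      using below_trans conv_below_sym by metis
  qed auto
  then show ?thesis using conn S' compose by auto
qed

lemma join_below:
  assumes "(s, t) \<in> join_mod R B" "(u, s) \<in> gt" "(u, t) \<in> gt"
  shows "(s, t) \<in> conv_below u"
proof -
  obtain c d where cd: "(s, c) \<in> (rstep R)\<^sup>*" "(c, d) \<in> simB B" "(t, d) \<in> (rstep R)\<^sup>*"
    using assms(1) unfolding join_mod_def rtrancl_converse by blast
  show ?thesis
    using rsteps_below[OF cd(1) assms(2)] simB_below[OF cd(2) rsteps_gt[OF cd(1) assms(2)]]
      rsteps_below[OF cd(3) assms(3)] conv_below_sym below_trans by metis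
qed

text \<open>The reduction from \<open>t\<close> cannot be empty, for then \<open>u\<close> would be
  greater than a term that is \<open>B\<close>-equivalent to \<open>u\<close>. Its first step is the
  one sought.\<close>

lemma join_cliff:
  assumes "(s, t) \<in> join_mod R B" "(u, s) \<in> gt" "(u, t) \<in> simB B"
  shows "\<exists>s'. (t, s') \<in> rstep R \<and> (s', s) \<in> conv_below u"
proof -
  obtain c d where cd: "(s, c) \<in> (rstep R)\<^sup>*" "(c, d) \<in> simB B" "(t, d) \<in> (rstep R)\<^sup>*"
    using assms(1) unfolding join_mod_def rtrancl_converse by blast
  have uc: "(u, c) \<in> gt" using cd(1) assms(2) by (rule rsteps_gt)
  from cd(3) show ?thesis
  proof (cases rule: converse_rtranclE)
    case base
    then have "(u, u) \<in> gt" using uc cd(2) assms(3) gt_simB simB_sym by metis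
    then show ?thesis using gt_irrefl by blast
  next
    case (step t1)
    have "(u, t1) \<in> gt" using assms(3) rstep_gt[OF step(1)] by (rule simB_gt)
    then have "(t1, d) \<in> conv_below u" using rsteps_below[OF step(2)] by simp
    then have "(t1, s) \<in> conv_below u"
      using rsteps_below[OF cd(1) assms(2)] simB_below[OF cd(2) uc] conv_below_sym below_trans by metis
    then show ?thesis using step(1) by blast
  qed
qed

end

theorem theorem4p12:
  fixes E B :: "('f, 'v) rule set" and gt :: "('f, 'v) trm rel"
    and run :: "nat \<Rightarrow> ('f, 'v) state" and n :: nat
  assumes "infinite (UNIV :: 'v set)"
    and "\<forall>(l, r) \<in> B. vars l = vars r"
    and "B_compatible_reduction_order B gt"
    and "is_run B gt E run n"
    and "fair B run n"
    and "\<not> fails run n"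
  shows "conv (E \<union> B) = conv (snd (run n) \<union> B)
       \<and> terminating_mod (snd (run n)) B
       \<and> CR_mod (snd (run n)) B"
proof -
  let ?R = "snd (run n)"
  have run0: "run 0 = (E, {})" and run_step: "\<And>i. i < n \<Longrightarrow> IA_step B gt (run i) (run (Suc i))"
    using assms(4) by (auto simp: is_run_def)
  have En: "fst (run n) = {}" using assms(6) by (simp add: fails_def)
  have gt: "snd (run i) \<subseteq> gt" if "i \<le> n" for i
    using that
  proof (induction i)
    case 0
    then show ?case using run0 by simp
  next
    case (Suc i)
    then show ?case using IA_step_gt[OF run_step[of i] assms(3)] by simp
  qed
  have "conv (fst (run i) \<union> snd (run i) \<union> B) = conv (E \<union> B)" if "i \<le> n" for i
    using that
  proof (induction i)
    case 0
    then show ?case using run0 by simp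
  next
    case (Suc i)
    then show ?case using IA_step_conv[OF run_step[of i]] by simp
  qed
  from this[of n] have conv: "conv (E \<union> B) = conv (?R \<union> B)" using En by simp
  interpret compatible_trs ?R B gt using assms(3) gt by unfold_locales simp_all
  \<comment> \<open>Induction downwards from \<open>n\<close>, where no equations remain and the
    rules are the final ones.\<close>
  have conn: "connects_eqs (fst (run i)) \<and> connects_rules (snd (run i))" if "i \<le> n" for i
    using that
  proof (induction rule: inc_induct)
    case base
    show ?case using connects_rules_self by (simp add: En connects_eqs_def rstep_def)
  next
    case (step i)
    then show ?case using IA_step_connects[OF run_step[of i]] gt[of i] by simp
  qed
  have rstep_gt_i: "(s, t) \<in> gt" if "(s, t) \<in> rstep (snd (run i))" "i \<le> n" for s t i
    using rstep_least[OF rewrite_closed_gt gt[OF that(2)]] that(1) by blast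
  have "fair_trs ?R B gt"
  proof unfold_locales
    show "left_linear ?R" using assms(5) by (simp add: fair_def)
    fix u s t
    assume us: "(u, s) \<in> rstep ?R"
    have gs: "(u, s) \<in> gt" using us by (rule rstep_gt)
    {
      let ?X = "join_mod ?R B \<union> (\<Union>i \<le> n. sstep (fst (run i) \<union> snd (run i)))"
      assume "(s, t) \<in> rstep (PCP ?R)" and ut: "(u, t) \<in> rstep ?R"
      \<comment> \<open>Fairness speaks about the critical pairs themselves; as the right-hand side
        is closed under contexts and substitutions, it also covers their instances.\<close>
      moreover have "rstep (PCP ?R) \<subseteq> ?X"
        using assms(5) unfolding fair_def
        by (intro rstep_least rewrite_closed_Un rewrite_closed_UN rewrite_closed_join_mod rewrite_closed_sstep) simp
      ultimately have "(s, t) \<in> ?X" by blast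
      moreover have gt': "(u, t) \<in> gt" using ut by (rule rstep_gt)
      ultimately consider "(s, t) \<in> join_mod ?R B"
        | i where "i \<le> n" "(s, t) \<in> rstep (fst (run i)) \<or> (t, s) \<in> rstep (fst (run i))"
        | i where "i \<le> n" "(s, t) \<in> rstep (snd (run i)) \<or> (t, s) \<in> rstep (snd (run i))"
        by (auto simp: sstep_def rstep_Un)
      then show "(s, t) \<in> below gt (sstep (?R \<union> B)) u"
      proof cases
        case 1
        then show ?thesis using gs gt' by (rule join_below)
      next
        case 2
        then show ?thesis using conn[of i] gs gt' conv_below_sym unfolding connects_eqs_def by blast
      next
        case 3
        then show ?thesis using conn[of i] gs gt' conv_below_sym connects_rules_below by blast
      qed
    next
      let ?X = "join_mod ?R B \<union> (\<Union>i \<le> n. sstep (snd (run i)))"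
      assume "(s, t) \<in> sstep (PCP_pm ?R B)" and ut: "(u, t) \<in> sstep B"
      moreover have "rstep (PCP_pm ?R B) \<subseteq> ?X"
        using assms(5) unfolding fair_def
        by (intro rstep_least rewrite_closed_Un rewrite_closed_UN rewrite_closed_join_mod rewrite_closed_sstep) simp
      ultimately have "(s, t) \<in> ?X \<or> (t, s) \<in> ?X" unfolding sstep_def by blast
      then consider "(s, t) \<in> join_mod ?R B"
        | i where "i \<le> n" "(s, t) \<in> rstep (snd (run i))" | i where "i \<le> n" "(t, s) \<in> rstep (snd (run i))"
        by (auto simp: sstep_def dest: sym_join_mod)
      then show "\<exists>s'. (t, s') \<in> rstep ?R \<and> (s', s) \<in> below gt (sstep (?R \<union> B)) u"
      proof cases
        case 1
        then show ?thesis using gs sstep_simB[OF ut] by (rule join_cliff)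
      next
        case 2
        \<comment> \<open>A rule step from \<open>s\<close> to \<open>t\<close> would make
          \<open>u\<close> greater than \<open>t\<close>, although both are
          \<open>B\<close>-equivalent; only the opposite direction is possible.\<close>
        then have "(u, t) \<in> gt" using gs rstep_gt_i gt_trans by blast
        then have "(u, u) \<in> gt" using sstep_simB[OF ut] gt_simB simB_sym by blast
        then show ?thesis using gt_irrefl by blast
      next
        case 3
        \<comment> \<open>The intermediate rule becomes a final step out of \<open>t\<close>; its
          bound \<open>t\<close> may be replaced by the \<open>B\<close>-equivalent
          \<open>u\<close>.\<close>
        then obtain s' where "(t, s') \<in> rstep ?R" "(s', s) \<in> conv_below t"
          using conn[of i] unfolding connects_rules_def by blast
        then show ?thesis using conv_below_simB[OF sstep_simB[OF ut]] by blast
      qed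
    }
  qed (use assms(1,2) in auto)
  then have "CR_mod ?R B" by (rule fair_trs.Church_Rosser)
  then show ?thesis using conv terminating by simp
qed

end
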